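(* Let $k \geq 1$ and let $\alpha,\beta \in (0,1)$ be computable reals such that $\beta = \frac{k\alpha}{1+(k-1)\alpha}$ (equivalently, $\alpha = \beta/(k-(k-1)\beta)$). Then there are $k$ partial computable functions $\Gamma_1, \ldots, \Gamma_k:\{0,1\}^*\to\{0,1\}^*$ such that for all $i,n$, whenever $|x|=\lfloor(\beta/\alpha)n\rfloor$ and $\Gamma_i(x)$ is defined, $\Gamma_i(x)\in\{0,1\}^n$, and a constant $d$ such that for every $n$ and every $x$ with $|x| = \lfloor(\beta/\alpha) n\rfloor$ and $C(x) \geq \alpha|x| + d$, there is some $i$ with $\Gamma_i(x)$ defined and $C(\Gamma_i(x)) \geq \beta n - d$.
   Context: $C$ denotes plain Kolmogorov complexity: $C(\sigma)=\min\{|p|:\mathbb{U}(p)=\sigma\}$ for a fixed optimal machine $\mathbb{U}$. *)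

theory Defs
  imports Complex_Main "HOL-Library.Extended_Nat" "HOL-Library.Extended_Real"
begin

datatype recf =
    Zero
  | Succ
  | Proj nat
  | Comp recf "recf list"
  | PrimRec recf recf
  | Mu recf

text \<open>\<open>evals r xs y\<close>: the partial recursive function denoted by \<open>r\<close> is defined on the argument
  tuple \<open>xs\<close> and has value \<open>y\<close>. Arities are implicit: a term applied to a tuple of unsuitable length
  has no value. Minimisation searches over the first argument and requires all
  earlier values to be defined and nonzero.\<close>

inductive evals :: "recf \<Rightarrow> nat list \<Rightarrow> nat \<Rightarrow> bool" where
  evals_Zero: "evals Zero xs 0"
| evals_Succ: "evals Succ [x] (Suc x)"
| evals_Proj: "i < length xs \<Longrightarrow> evals (Proj i) xs (xs ! i)"
| evals_Comp: "list_all2 (\<lambda>g y. evals g xs y) gs ys \<Longrightarrow> evals f ys z \<Longrightarrow> evals (Comp f gs) xs z"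
| evals_PrimRec_0: "evals f xs y \<Longrightarrow> evals (PrimRec f g) (0 # xs) y"
| evals_PrimRec_Suc:
    "evals (PrimRec f g) (n # xs) r \<Longrightarrow> evals g (n # r # xs) y \<Longrightarrow> evals (PrimRec f g) (Suc n # xs) y"
| evals_Mu:
    "evals f (n # xs) 0 \<Longrightarrow> (\<forall>m<n. \<exists>v. evals f (m # xs) (Suc v)) \<Longrightarrow> evals (Mu f) xs n"
monos list_all2_mono

lemma evals_deterministic: "evals r xs y \<Longrightarrow> evals r xs z \<Longrightarrow> y = z"
proof (induction arbitrary: z rule: evals.induct)
  case (evals_Zero xs)
  then show ?case by (auto elim: evals.cases)
next
  case (evals_Succ x)
  then show ?case by (auto elim: evals.cases)
next
  case (evals_Proj i xs)
  from evals_Proj.prems show ?case by cases auto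
next
  case (evals_Comp xs gs ys f w)
  from evals_Comp.prems obtain ys' where ys': "list_all2 (\<lambda>g y. evals g xs y) gs ys'" "evals f ys' z"
    by cases auto
  have "ys = ys'"
    using evals_Comp.IH(1) ys'(1)
    by (auto simp: list_all2_conv_all_nth intro!: nth_equalityI)
  with evals_Comp.IH(2) ys'(2) show ?case by blast
next
  case (evals_PrimRec_0 f xs y g)
  from evals_PrimRec_0.prems show ?case by cases (use evals_PrimRec_0.IH in auto)
next
  case (evals_PrimRec_Suc f g n xs r y)
  from evals_PrimRec_Suc.prems show ?case by cases (use evals_PrimRec_Suc.IH in blast)+
next
  case (evals_Mu f n xs)
  from evals_Mu.prems have z: "evals f (z # xs) 0" "\<forall>m<z. \<exists>v. evals f (m # xs) (Suc v)"
    by (cases, auto)+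
  have "\<not> z < n" using evals_Mu.IH(2) z(1) by fastforce
  moreover have "\<not> n < z" using evals_Mu.IH(1) z(2) by fastforce
  ultimately show ?case by simp
qed

text \<open>The bijective base-2 numeral identification of binary strings with natural numbers.\<close>

fun str_code :: "bool list \<Rightarrow> nat" where
  "str_code [] = 0"
| "str_code (b # bs) = 2 * str_code bs + (if b then 2 else 1)"

lemma bij_str_code: "bij str_code"
proof (rule bijI)
  have "str_code x = str_code y \<Longrightarrow> x = y" for x y
  proof (induction x arbitrary: y)
    case Nil
    then show ?case by (cases y) (auto split: if_splits)
  next
    case (Cons a x)
    then show ?case by (cases y) (auto split: if_splits, presburger+)
  qed
  then show "inj str_code" by (rule injI)
  have "\<exists>x. str_code x = n" for n
  proof (induction n rule: less_induct)
    case (less n)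
    show ?case
    proof (cases "n = 0")
      case True
      then show ?thesis by (intro exI[of _ "[]"]) simp
    next
      case False
      then have "(n - 1) div 2 < n" by simp
      then obtain x where x: "str_code x = (n - 1) div 2" using less by blast
      have "str_code (even n # x) = n" using False x by (auto elim!: evenE oddE)
      then show ?thesis ..
    qed
  qed
  then show "surj str_code" by (auto simp: surj_def) metis
qed

definition partial_computable :: "(bool list \<Rightarrow> bool list option) \<Rightarrow> bool" where
  "partial_computable f \<longleftrightarrow>
     (\<exists>r. \<forall>x y. f x = Some y \<longleftrightarrow> evals r [str_code x] (str_code y))"

definition total_recursive :: "(nat \<Rightarrow> nat) \<Rightarrow> bool" where
  "total_recursive f \<longleftrightarrow> (\<exists>r. \<forall>n. evals r [n] (f n))"

text \<open>A real is computable if a computable sequence of rationals converges to it with the effective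
  error bound \<open>2\<^sup>-\<^sup>n\<close>; the rationals are presented as \<open>(a n - b n) / (c n + 1)\<close>.\<close>

definition computable_real :: "real \<Rightarrow> bool" where
  "computable_real t \<longleftrightarrow>
     (\<exists>a b c. total_recursive a \<and> total_recursive b \<and> total_recursive c \<and>
        (\<forall>n. \<bar>t - (real (a n) - real (b n)) / real (c n + 1)\<bar> \<le> 1 / 2 ^ n))"

text \<open>The value is \<open>\<infinity>\<close> if \<open>s\<close> has no description under \<open>M\<close>; for an optimal \<open>M\<close> this never happens,
  and the infimum is the minimum.\<close>

definition complexity :: "(bool list \<Rightarrow> bool list option) \<Rightarrow> bool list \<Rightarrow> enat" where
  "complexity M s = (INF p\<in>{p. M p = Some s}. enat (length p))"

definition optimal_machine :: "(bool list \<Rightarrow> bool list option) \<Rightarrow> bool" where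
  "optimal_machine U \<longleftrightarrow> partial_computable U \<and>
     (\<forall>M. partial_computable M \<longrightarrow> (\<exists>c::nat. \<forall>s. complexity U s \<le> complexity M s + enat c))"

end

theory Submission
  imports Defs
begin

text \<open>
  Let \<open>m = |x|\<close> and call a string of length \<open>n\<close> simple if it has a program of fewer than
  \<open>s = \<lceil>\<alpha> m\<rceil>\<close> bits, where \<open>\<alpha> m\<close> and \<open>\<beta> n\<close> differ by at most one. There are fewer than \<open>2\<^sup>s\<close> simple
  strings and they can be enumerated. In round 1 all strings of length \<open>m\<close> are spread evenly over
  the strings of length \<open>n\<close>; whenever the value of \<open>x\<close> in round \<open>i\<close> turns out to be simple, \<open>x\<close>
  enters round \<open>i + 1\<close>, where it gets the next value in cyclic order. Hence the number \<open>N\<^sub>i\<close> of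
  strings that leave round \<open>i\<close> satisfies \<open>N\<^sub>i\<^sub>+\<^sub>1 \<le> 2\<^sup>s (N\<^sub>i / 2\<^sup>n + 1)\<close> with \<open>N\<^sub>0 = 2\<^sup>m\<close>. The relation
  between \<open>\<alpha>\<close> and \<open>\<beta>\<close> says \<open>m + k (s - n) \<approx> s\<close>, so \<open>N\<^sub>k = O(2\<^sup>s)\<close>. A string that leaves the last
  round is described by its rank among these and a constant amount of advice that determines
  \<open>m\<close> from \<open>s\<close>; thus \<open>C(x) \<le> \<alpha> m + O(1)\<close>.
\<close>

section \<open>Closure properties of recursive functions\<close>

text \<open>The default 0 makes every projection total, so \<open>recursive_arg\<close> holds for
  all \<open>i\<close> and \<open>n\<close>.\<close>

definition arg :: "nat \<Rightarrow> nat list \<Rightarrow> nat" where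
  "arg i xs = (if i < length xs then xs ! i else 0)"

lemma arg_Cons_0 [simp]: "arg 0 (x # xs) = x"
  and arg_Cons_Suc [simp]: "arg (Suc i) (x # xs) = arg i xs"
  by (simp_all add: arg_def)

lemma arg_Cons_1 [simp]: "arg 1 (x # xs) = arg 0 xs"
  by (simp add: arg_def)

lemma arg_tl: "arg i (tl xs) = arg (Suc i) xs"
  by (cases xs) (simp_all add: arg_def)

definition recursive :: "nat \<Rightarrow> (nat list \<Rightarrow> nat) \<Rightarrow> bool" where
  "recursive n f \<longleftrightarrow> (\<exists>r. \<forall>xs. length xs = n \<longrightarrow> evals r xs (f xs))"

definition recursive_tuple :: "nat \<Rightarrow> nat \<Rightarrow> (nat list \<Rightarrow> nat list) \<Rightarrow> bool" where
  "recursive_tuple n m G \<longleftrightarrow>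
     (\<exists>gs. length gs = m \<and> (\<forall>xs. length xs = n \<longrightarrow> list_all2 (\<lambda>g y. evals g xs y) gs (G xs)))"

definition decidable :: "nat \<Rightarrow> (nat list \<Rightarrow> bool) \<Rightarrow> bool" where
  "decidable n P \<longleftrightarrow> recursive n (\<lambda>xs. of_bool (P xs))"

text \<open>Closure rules that follow the structure of a term. A binder puts its variable in front
  of the tuple: the body reads it as \<open>arg 0 ys\<close> and the old arguments as
  \<open>tl ys\<close>.\<close>

named_theorems rec_intros

lemma recursive_cong:
  assumes "\<And>xs. length xs = n \<Longrightarrow> f xs = g xs"
  shows "recursive n f \<longleftrightarrow> recursive n g"
  using assms by (auto simp: recursive_def)

lemma recursive_compose:
  assumes "recursive m f" "recursive_tuple n m G"
  shows "recursive n (\<lambda>xs. f (G xs))"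
proof -
  obtain r where r: "\<And>xs. length xs = m \<Longrightarrow> evals r xs (f xs)"
    using assms(1) by (auto simp: recursive_def)
  obtain gs where gs: "length gs = m"
    "\<And>xs. length xs = n \<Longrightarrow> list_all2 (\<lambda>g y. evals g xs y) gs (G xs)"
    using assms(2) by (auto simp: recursive_tuple_def)
  have "evals (Comp r gs) xs (f (G xs))" if "length xs = n" for xs
    using gs(2)[OF that] by (rule evals_Comp) (use gs that r list_all2_lengthD in metis)
  then show ?thesis by (auto simp: recursive_def)
qed

lemma recursive_tuple_Nil: "recursive_tuple n 0 (\<lambda>xs. [])"
  by (simp add: recursive_tuple_def)

lemma recursive_tuple_Cons:
  assumes "recursive n f" "recursive_tuple n m G"
  shows "recursive_tuple n (Suc m) (\<lambda>xs. f xs # G xs)"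
proof -
  obtain r where r: "\<And>xs. length xs = n \<Longrightarrow> evals r xs (f xs)"
    using assms(1) by (auto simp: recursive_def)
  obtain gs where gs: "length gs = m"
    "\<And>xs. length xs = n \<Longrightarrow> list_all2 (\<lambda>g y. evals g xs y) gs (G xs)"
    using assms(2) by (auto simp: recursive_tuple_def)
  show ?thesis
    unfolding recursive_tuple_def by (rule exI[of _ "r # gs"]) (use r gs in auto)
qed

lemma recursive_tuple_id: "recursive_tuple n n (\<lambda>xs. xs)"
  unfolding recursive_tuple_def
  by (rule exI[of _ "map Proj [0..<n]"]) (auto simp: list_all2_conv_all_nth intro: evals_Proj)

lemma recursive_tuple_tl:
  assumes "recursive_tuple n (Suc m) G"
  shows "recursive_tuple n m (\<lambda>xs. tl (G xs))"
proof -
  obtain gs where gs: "length gs = Suc m"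
    "\<And>xs. length xs = n \<Longrightarrow> list_all2 (\<lambda>g y. evals g xs y) gs (G xs)"
    using assms by (auto simp: recursive_tuple_def)
  have "list_all2 (\<lambda>g y. evals g xs y) (tl gs) (tl (G xs))" if "length xs = n" for xs
    using gs(2)[OF that] gs(1) by (auto simp: list_all2_Cons1 length_Suc_conv)
  then show ?thesis
    using gs(1) by (auto simp: recursive_tuple_def intro!: exI[of _ "tl gs"])
qed

lemma recursive_tuple_map:
  assumes "\<And>g. g \<in> set gs \<Longrightarrow> recursive n (F g)"
  shows "recursive_tuple n (length gs) (\<lambda>xs. map (\<lambda>g. F g xs) gs)"
  using assms by (induction gs) (auto intro: recursive_tuple_Nil recursive_tuple_Cons)

lemma recursive_arg [rec_intros]: "recursive n (\<lambda>xs. arg i xs)"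
proof (cases "i < n")
  case True
  then show ?thesis
    unfolding recursive_def by (intro exI[of _ "Proj i"]) (auto simp: arg_def intro: evals_Proj)
next
  case False
  then show ?thesis
    unfolding recursive_def by (intro exI[of _ Zero]) (auto simp: arg_def intro: evals_Zero)
qed

text \<open>Each binder wraps the tuple in a \<open>tl\<close>; this rule trades it for a larger
  index until \<open>recursive_arg\<close> applies.\<close>

lemma recursive_arg_tl [rec_intros]:
  "recursive n (\<lambda>xs. arg (Suc i) (G xs)) \<Longrightarrow> recursive n (\<lambda>xs. arg i (tl (G xs)))"
  by (simp add: arg_tl)

lemma recursive_unary:
  assumes "recursive 1 (\<lambda>xs. f (arg 0 xs))" "recursive n a"
  shows "recursive n (\<lambda>xs. f (a xs))"
  using recursive_compose[OF assms(1), of n "\<lambda>xs. [a xs]"] assms(2)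
  by (simp add: recursive_tuple_Cons recursive_tuple_Nil)

lemma recursive_binary:
  assumes "recursive 2 (\<lambda>xs. f (arg 0 xs) (arg 1 xs))" "recursive n a" "recursive n b"
  shows "recursive n (\<lambda>xs. f (a xs) (b xs))"
  using recursive_compose[OF assms(1), of n "\<lambda>xs. [a xs, b xs]"] assms(2,3)
  by (simp add: recursive_tuple_Cons recursive_tuple_Nil numeral_2_eq_2)

lemma recursive_Suc [rec_intros]: "recursive n f \<Longrightarrow> recursive n (\<lambda>xs. Suc (f xs))"
  by (rule recursive_unary)
    (auto simp: recursive_def length_Suc_conv intro!: exI[of _ Succ] evals_Succ)

lemma recursive_const [rec_intros]: "recursive n (\<lambda>xs. c)"
proof (induction c)
  case 0
  show ?case by (auto simp: recursive_def intro: evals_Zero)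
next
  case (Suc c)
  then show ?case by (rule recursive_Suc)
qed

lemma recursive_rec_nat:
  assumes a: "recursive n a" and b: "recursive n b"
    and c: "recursive (Suc (Suc n)) (\<lambda>ys. c (arg 0 ys) (arg 1 ys) (tl (tl ys)))"
  shows "recursive n (\<lambda>xs. rec_nat (b xs) (\<lambda>i r. c i r xs) (a xs))"
proof -
  obtain rb where rb: "\<And>xs. length xs = n \<Longrightarrow> evals rb xs (b xs)"
    using b by (auto simp: recursive_def)
  obtain rc where "\<And>xs. length xs = Suc (Suc n) \<Longrightarrow> evals rc xs (c (arg 0 xs) (arg 1 xs) (tl (tl xs)))"
    using c by (auto simp: recursive_def)
  from this[of "i # r # xs" for i r xs]
  have rc: "evals rc (i # r # xs) (c i r xs)" if "length xs = n" for i r xs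
    using that by simp
  have "evals (PrimRec rb rc) (j # xs) (rec_nat (b xs) (\<lambda>i r. c i r xs) j)"
    if "length xs = n" for j xs
    by (induction j) (use that rb rc in \<open>auto intro: evals_PrimRec_0 evals_PrimRec_Suc\<close>)
  then have "recursive (Suc n) (\<lambda>ys. rec_nat (b (tl ys)) (\<lambda>i r. c i r (tl ys)) (arg 0 ys))"
    unfolding recursive_def by (intro exI[of _ "PrimRec rb rc"]) (auto simp: length_Suc_conv)
  from recursive_compose[OF this recursive_tuple_Cons[OF a recursive_tuple_id]] show ?thesis
    by simp
qed

lemma recursive_pred [rec_intros]:
  assumes "recursive n f" shows "recursive n (\<lambda>xs. f xs - 1)"
proof -
  have "recursive n (\<lambda>xs. rec_nat 0 (\<lambda>i r. i) (f xs))"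
    by (intro recursive_rec_nat rec_intros assms)
  moreover have "rec_nat 0 (\<lambda>i r. i) x = x - 1" for x :: nat by (cases x) auto
  ultimately show ?thesis by simp
qed

lemma recursive_add [rec_intros]:
  assumes "recursive n f" "recursive n g" shows "recursive n (\<lambda>xs. f xs + g xs)"
proof -
  have "recursive n (\<lambda>xs. rec_nat (f xs) (\<lambda>i r. Suc r) (g xs))"
    by (intro recursive_rec_nat rec_intros assms)
  moreover have "rec_nat x (\<lambda>i r. Suc r) y = x + y" for x y :: nat by (induction y) auto
  ultimately show ?thesis by simp
qed

lemma recursive_diff [rec_intros]:
  assumes "recursive n f" "recursive n g" shows "recursive n (\<lambda>xs. f xs - g xs)"
proof -
  have "recursive n (\<lambda>xs. rec_nat (f xs) (\<lambda>i r. r - 1) (g xs))"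
    by (intro recursive_rec_nat rec_intros assms)
  moreover have "rec_nat x (\<lambda>i r. r - 1) y = x - y" for x y :: nat by (induction y) auto
  ultimately show ?thesis by simp
qed

lemma recursive_sum [rec_intros]:
  assumes "recursive n a" "recursive (Suc n) (\<lambda>ys. f (arg 0 ys) (tl ys))"
  shows "recursive n (\<lambda>xs. \<Sum>i<a xs. f i xs)"
proof -
  have *: "(\<Sum>i<a. g i) = rec_nat 0 (\<lambda>i r. r + g i) a" for a and g :: "nat \<Rightarrow> nat"
    by (induction a) auto
  \<comment> \<open>The recursion step also sees the accumulator; composing with a tuple that omits
    it brings \<open>f\<close> into this context.\<close>
  have "recursive (Suc (Suc n)) (\<lambda>ys. f (arg 0 (arg 0 ys # tl (tl ys))) (tl (arg 0 ys # tl (tl ys))))"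
    by (rule recursive_compose[OF assms(2)], rule recursive_tuple_Cons[OF recursive_arg])
      (intro recursive_tuple_tl recursive_tuple_id)
  then show ?thesis
    unfolding * by (intro recursive_rec_nat rec_intros assms) simp
qed

lemma recursive_mult [rec_intros]:
  assumes "recursive n f" "recursive n g" shows "recursive n (\<lambda>xs. f xs * g xs)"
proof -
  have "recursive 2 (\<lambda>xs. \<Sum>i<arg 0 xs. arg 1 xs)"
    by (intro rec_intros)
  then show ?thesis
    using recursive_binary[of "(*)", OF _ assms] by simp
qed

lemma recursive_power [rec_intros]:
  assumes "recursive n f" "recursive n g" shows "recursive n (\<lambda>xs. f xs ^ g xs)"
proof -
  have "recursive 2 (\<lambda>xs. rec_nat 1 (\<lambda>i r. arg 0 xs * r) (arg 1 xs))"
    by (intro recursive_rec_nat rec_intros)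
  moreover have "x ^ y = rec_nat 1 (\<lambda>i r. x * r) y" for x y :: nat by (induction y) auto
  ultimately show ?thesis
    using recursive_binary[of "(^)", OF _ assms] by simp
qed

lemma recursive_of_bool [rec_intros]: "decidable n P \<Longrightarrow> recursive n (\<lambda>xs. of_bool (P xs))"
  by (simp add: decidable_def)

lemma decidable_binary:
  assumes "decidable 2 (\<lambda>xs. P (arg 0 xs) (arg 1 xs))" "recursive n a" "recursive n b"
  shows "decidable n (\<lambda>xs. P (a xs) (b xs))"
  using recursive_binary[of "\<lambda>x y. of_bool (P x y)" n a b] assms by (simp add: decidable_def)

lemma decidable_le [rec_intros]:
  assumes "recursive n f" "recursive n g" shows "decidable n (\<lambda>xs. f xs \<le> g xs)"
proof -
  have "of_bool (x \<le> y) = 1 - (x - y)" for x y :: nat by auto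
  then show ?thesis
    unfolding decidable_def by (simp only:) (intro rec_intros assms)
qed

lemma decidable_less [rec_intros]:
  assumes "recursive n f" "recursive n g" shows "decidable n (\<lambda>xs. f xs < g xs)"
  using decidable_le[OF recursive_Suc[OF assms(1)] assms(2)] by (simp add: Suc_le_eq)

lemma decidable_not [rec_intros]:
  assumes "decidable n P" shows "decidable n (\<lambda>xs. \<not> P xs)"
proof -
  have "of_bool (\<not> p) = 1 - (of_bool p :: nat)" for p by auto
  then show ?thesis
    unfolding decidable_def by (simp only:) (intro rec_intros assms)
qed

lemma decidable_conj [rec_intros]:
  assumes "decidable n P" "decidable n Q" shows "decidable n (\<lambda>xs. P xs \<and> Q xs)"
  unfolding decidable_def of_bool_conj by (intro rec_intros assms)

lemma decidable_disj [rec_intros]: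
  assumes "decidable n P" "decidable n Q" shows "decidable n (\<lambda>xs. P xs \<or> Q xs)"
  using decidable_not[OF decidable_conj[OF assms[THEN decidable_not]]] by simp

lemma decidable_imp [rec_intros]:
  assumes "decidable n P" "decidable n Q" shows "decidable n (\<lambda>xs. P xs \<longrightarrow> Q xs)"
  using decidable_disj[OF assms(1)[THEN decidable_not] assms(2)] by (simp only: imp_conv_disj)

lemma decidable_eq [rec_intros]:
  assumes "recursive n f" "recursive n g" shows "decidable n (\<lambda>xs. f xs = g xs)"
  unfolding eq_iff[of "f _"] by (intro rec_intros assms)

lemma decidable_ex_less [rec_intros]:
  assumes "recursive n a" "decidable (Suc n) (\<lambda>ys. P (arg 0 ys) (tl ys))"
  shows "decidable n (\<lambda>xs. \<exists>i<a xs. P i xs)"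
proof -
  have "0 < (\<Sum>i<b. of_bool (Q i) :: nat) \<longleftrightarrow> (\<exists>i<b. Q i)" for b :: nat and Q
    unfolding neq0_conv[symmetric] by (subst sum_eq_0_iff) auto
  moreover have "decidable n (\<lambda>xs. 0 < (\<Sum>i<a xs. of_bool (P i xs) :: nat))"
    by (intro rec_intros assms)
  ultimately show ?thesis by simp
qed

lemma decidable_all_less [rec_intros]:
  assumes "recursive n a" "decidable (Suc n) (\<lambda>ys. P (arg 0 ys) (tl ys))"
  shows "decidable n (\<lambda>xs. \<forall>i<a xs. P i xs)"
  using decidable_not[OF decidable_ex_less[OF assms(1) decidable_not[OF assms(2)]]] by simp

lemma recursive_if [rec_intros]:
  assumes "decidable n P" "recursive n f" "recursive n g"
  shows "recursive n (\<lambda>xs. if P xs then f xs else g xs)"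
proof -
  have "recursive n (\<lambda>xs. of_bool (P xs) * f xs + of_bool (\<not> P xs) * g xs)"
    by (intro rec_intros assms)
  then show ?thesis
    by (rule recursive_cong[THEN iffD1, rotated]) auto
qed

lemma recursive_div [rec_intros]:
  assumes "recursive n f" "recursive n g" shows "recursive n (\<lambda>xs. f xs div g xs)"
proof -
  \<comment> \<open>The quotient counts the positive multiples of \<open>y\<close> up to
    \<open>x\<close>; \<open>y = 0\<close> is separate because every \<open>i\<close> would be
    counted although \<open>x div 0 = 0\<close>.\<close>
  have *: "(if y = 0 then 0 else \<Sum>i<x. of_bool (Suc i * y \<le> x)) = x div y" for x y :: nat
  proof (cases "y = 0")
    case False
    have "(\<Sum>i<x. of_bool (Suc i * y \<le> x)) = card {i. i < x \<and> Suc i * y \<le> x}"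
      by (simp add: of_bool_def sum.If_cases Int_def del: mult_Suc)
    also have "{i. i < x \<and> Suc i * y \<le> x} = {..<x div y}"
    proof -
      have "Suc i * y \<le> x \<longleftrightarrow> i < x div y" for i
        using less_eq_div_iff_mult_less_eq[of y "Suc i" x] False by (simp only: Suc_le_eq neq0_conv)
      moreover have "i < x" if "i < x div y" for i
        using that div_le_dividend[of x y] by linarith
      ultimately show ?thesis by auto
    qed
    finally show ?thesis using False by simp
  qed simp
  have "recursive 2 (\<lambda>xs. if arg 1 xs = 0 then 0
      else \<Sum>i<arg 0 xs. of_bool (Suc i * arg 1 xs \<le> arg 0 xs))"
    by (intro rec_intros)
  then show ?thesis
    unfolding * by (rule recursive_binary[OF _ assms])
qed

lemma recursive_mod [rec_intros]:
  assumes "recursive n f" "recursive n g" shows "recursive n (\<lambda>xs. f xs mod g xs)"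
  unfolding minus_div_mult_eq_mod[symmetric] by (intro rec_intros assms)

text \<open>\<open>Mu\<close> searches for a zero, hence the negated indicator. No witness is
  required to exist, so this serves both \<open>LEAST\<close> and partial searches.\<close>

lemma evals_Mu_iff:
  assumes "\<And>z. evals r (z # xs) (of_bool (\<not> P z))"
  shows "evals (Mu r) xs z \<longleftrightarrow> P z \<and> (\<forall>w<z. \<not> P w)"
proof -
  have r: "evals r (w # xs) v \<longleftrightarrow> v = of_bool (\<not> P w)" for w v
    using assms evals_deterministic by blast
  show ?thesis
    by (subst evals.simps) (auto simp: r)
qed

lemma recursive_Least [rec_intros]:
  assumes "\<And>xs. length xs = n \<Longrightarrow> \<exists>z. P z xs"
    and "decidable (Suc n) (\<lambda>ys. P (arg 0 ys) (tl ys))"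
  shows "recursive n (\<lambda>xs. LEAST z. P z xs)"
proof -
  obtain r where "\<And>ys. length ys = Suc n \<Longrightarrow> evals r ys (of_bool (\<not> P (arg 0 ys) (tl ys)))"
    using decidable_not[OF assms(2)] by (auto simp: decidable_def recursive_def)
  from this[of "z # xs" for z xs]
  have "evals r (z # xs) (of_bool (\<not> P z xs))" if "length xs = n" for z xs
    using that by simp
  note Mu = evals_Mu_iff[of r, OF this]
  show ?thesis
    unfolding recursive_def
    by (rule exI[of _ "Mu r"]) (use assms(1) in \<open>auto simp: Mu intro: LeastI_ex dest: not_less_Least\<close>)
qed

section \<open>Step-bounded evaluation\<close>

lemma decidable_Ball_list:
  assumes "\<And>g. g \<in> set gs \<Longrightarrow> decidable n (P g)"
  shows "decidable n (\<lambda>xs. \<forall>g\<in>set gs. P g xs)"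
  using assms
proof (induction gs)
  case Nil
  then show ?case by (simp add: decidable_def recursive_const)
next
  case (Cons g gs)
  then show ?case using decidable_conj[of n "P g"] by simp
qed

text \<open>The value \<open>T t xs\<close> is \<open>Suc y\<close> if \<open>r\<close> has been found to output \<open>y\<close> within time \<open>t\<close>, and \<open>0\<close>
  if no output is known yet.\<close>

definition step_function :: "recf \<Rightarrow> nat \<Rightarrow> (nat \<Rightarrow> nat list \<Rightarrow> nat) \<Rightarrow> bool" where
  "step_function r n T \<longleftrightarrow> recursive (Suc n) (\<lambda>ys. T (arg 0 ys) (tl ys)) \<and>
     (\<forall>xs. length xs = n \<longrightarrow>
        (\<forall>y. evals r xs y \<longleftrightarrow> (\<exists>t. T t xs = Suc y)) \<and>
        (\<forall>t t' y. t \<le> t' \<longrightarrow> T t xs = Suc y \<longrightarrow> T t' xs = Suc y))"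

lemma step_functionI:
  assumes "recursive (Suc n) (\<lambda>ys. T (arg 0 ys) (tl ys))"
    and "\<And>xs y. length xs = n \<Longrightarrow> evals r xs y \<Longrightarrow> \<exists>t. T t xs = Suc y"
    and "\<And>xs t y. length xs = n \<Longrightarrow> T t xs = Suc y \<Longrightarrow> evals r xs y"
    and "\<And>xs t t' y. length xs = n \<Longrightarrow> t \<le> t' \<Longrightarrow> T t xs = Suc y \<Longrightarrow> T t' xs = Suc y"
  shows "step_function r n T"
  using assms unfolding step_function_def by blast

lemma step_functionD:
  assumes "step_function r n T"
  shows "recursive (Suc n) (\<lambda>ys. T (arg 0 ys) (tl ys))"
    and "length xs = n \<Longrightarrow> evals r xs y \<Longrightarrow> \<exists>t. T t xs = Suc y"
    and "length xs = n \<Longrightarrow> T t xs = Suc y \<Longrightarrow> evals r xs y"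
    and "length xs = n \<Longrightarrow> T t xs = Suc y \<Longrightarrow> t \<le> t' \<Longrightarrow> T t' xs = Suc y"
  using assms unfolding step_function_def by blast+

inductive_cases evals_SuccE: "evals Succ xs y"
inductive_cases evals_ProjE: "evals (Proj i) xs y"
inductive_cases evals_CompE: "evals (Comp f gs) xs y"
inductive_cases evals_PrimRecE: "evals (PrimRec f g) xs y"
inductive_cases evals_MuE: "evals (Mu f) xs y"

text \<open>The outer term starts once all inner values are known. As answers persist, the sum of
  finitely many running times is a common bound.\<close>

lemma step_function_Comp:
  assumes f: "step_function f (length gs) Tf" and g: "\<And>g. g \<in> set gs \<Longrightarrow> step_function g n (Tg g)"
  shows "step_function (Comp f gs) n
    (\<lambda>t xs. if \<forall>g\<in>set gs. Tg g t xs \<noteq> 0 then Tf t (map (\<lambda>g. Tg g t xs - 1) gs) else 0)"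
    (is "step_function _ _ ?T")
proof (rule step_functionI)
  have "recursive (Suc n) (\<lambda>ys. Tf (arg 0 (arg 0 ys # map (\<lambda>g. Tg g (arg 0 ys) (tl ys) - 1) gs))
      (tl (arg 0 ys # map (\<lambda>g. Tg g (arg 0 ys) (tl ys) - 1) gs)))"
    by (intro recursive_compose[OF step_functionD(1)[OF f]] recursive_tuple_Cons recursive_tuple_map
        rec_intros step_functionD(1)[OF g])
  then show "recursive (Suc n) (\<lambda>ys. ?T (arg 0 ys) (tl ys))"
    by (intro rec_intros decidable_Ball_list step_functionD(1)[OF g]) simp_all
next
  fix xs y assume xs: "length xs = n" and "evals (Comp f gs) xs y"
  then obtain ys where ys: "list_all2 (\<lambda>g y. evals g xs y) gs ys" "evals f ys y"
    by (auto elim: evals_CompE)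
  have len: "length ys = length gs" using ys(1) by (simp add: list_all2_lengthD)
  have "\<exists>t. \<forall>i<length gs. Tg (gs ! i) t xs = Suc (ys ! i)"
  proof -
    have "\<forall>i\<in>{..<length gs}. \<exists>t. Tg (gs ! i) t xs = Suc (ys ! i)"
    proof
      fix i assume "i \<in> {..<length gs}"
      then show "\<exists>t. Tg (gs ! i) t xs = Suc (ys ! i)"
        by (intro step_functionD(2)[OF g xs]) (use ys(1) in \<open>simp_all add: list_all2_conv_all_nth\<close>)
    qed
    then obtain t where t: "\<forall>i\<in>{..<length gs}. Tg (gs ! i) (t i) xs = Suc (ys ! i)"
      by (auto dest: bchoice)
    have "Tg (gs ! i) (\<Sum>i<length gs. t i) xs = Suc (ys ! i)" if "i < length gs" for i
    proof (rule step_functionD(4)[OF g xs])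
      show "t i \<le> (\<Sum>i<length gs. t i)" using that by (intro member_le_sum) auto
    qed (use that t in simp_all)
    then show ?thesis by blast
  qed
  then obtain t where t: "\<forall>i<length gs. Tg (gs ! i) t xs = Suc (ys ! i)" by blast
  obtain t' where t': "Tf t' ys = Suc y"
    using step_functionD(2)[OF f len ys(2)] by blast
  have T: "Tg (gs ! i) (max t t') xs = Suc (ys ! i)" if "i < length gs" for i
    by (rule step_functionD(4)[OF g xs, of _ t]) (use that t in simp_all)
  then have "map (\<lambda>g. Tg g (max t t') xs - 1) gs = ys"
    using len by (auto intro: nth_equalityI)
  moreover have "\<forall>g\<in>set gs. Tg g (max t t') xs \<noteq> 0"
    using T by (auto simp: in_set_conv_nth)
  moreover have "Tf (max t t') ys = Suc y"
    using step_functionD(4)[OF f len t', of "max t t'"] by simp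
  ultimately show "\<exists>t. ?T t xs = Suc y" by (intro exI[of _ "max t t'"]) simp
next
  fix xs t y assume xs: "length xs = n" and T: "?T t xs = Suc y"
  then have 1: "\<forall>g\<in>set gs. Tg g t xs \<noteq> 0" and 2: "Tf t (map (\<lambda>g. Tg g t xs - 1) gs) = Suc y"
    by (auto split: if_splits)
  have "evals g xs (Tg g t xs - 1)" if "g \<in> set gs" for g
    by (rule step_functionD(3)[OF g[OF that] xs, of t]) (use 1 that in auto)
  then have "list_all2 (\<lambda>g y. evals g xs y) gs (map (\<lambda>g. Tg g t xs - 1) gs)"
    by (simp add: list_all2_conv_all_nth)
  moreover have "evals f (map (\<lambda>g. Tg g t xs - 1) gs) y"
    using step_functionD(3)[OF f _ 2] by simp
  ultimately show "evals (Comp f gs) xs y" by (rule evals_Comp)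
next
  fix xs t t' y assume xs: "length xs = n" and t: "t \<le> t'" and T: "?T t xs = Suc y"
  then have 1: "\<forall>g\<in>set gs. Tg g t xs \<noteq> 0" and 2: "Tf t (map (\<lambda>g. Tg g t xs - 1) gs) = Suc y"
    by (auto split: if_splits)
  have 3: "Tg g t' xs = Tg g t xs" if "g \<in> set gs" for g
    using step_functionD(4)[OF g[OF that] xs, of t _ t'] 1 that t by (cases "Tg g t xs") auto
  then have "map (\<lambda>g. Tg g t' xs - 1) gs = map (\<lambda>g. Tg g t xs - 1) gs" by simp
  then have "Tf t' (map (\<lambda>g. Tg g t' xs - 1) gs) = Suc y"
    using step_functionD(4)[OF f _ 2 t] by (simp only: length_map)
  moreover have "\<forall>g\<in>set gs. Tg g t' xs \<noteq> 0" using 1 3 by metis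
  ultimately show "?T t' xs = Suc y" by simp
qed

text \<open>An unknown intermediate value 0 is passed on; otherwise \<open>r - 1\<close> undoes the
  successor that marks a known value.\<close>

lemma step_function_PrimRec:
  assumes f: "step_function f n Tf" and g: "step_function g (Suc (Suc n)) Tg"
  shows "step_function (PrimRec f g) (Suc n)
    (\<lambda>t xs. rec_nat (Tf t (tl xs))
       (\<lambda>j r. if r = 0 then 0 else Tg t (j # (r - 1) # tl xs)) (arg 0 xs))"
    (is "step_function _ _ ?T")
proof -
  define R where "R t zs = rec_nat (Tf t zs) (\<lambda>j r. if r = 0 then 0 else Tg t (j # (r - 1) # zs))" for t zs
  have R_0: "R t zs 0 = Tf t zs"
    and R_Suc: "R t zs (Suc k) = (if R t zs k = 0 then 0 else Tg t (k # (R t zs k - 1) # zs))" for t zs k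
    by (simp_all add: R_def)
  have mono: "R t' zs k = Suc y" if "R t zs k = Suc y" "t \<le> t'" "length zs = n" for t t' y k zs
    using that(1)
  proof (induction k arbitrary: y)
    case 0
    then show ?case using step_functionD(4)[OF f that(3), of t y t'] that(2) by (simp add: R_0)
  next
    case (Suc k)
    then obtain r where r: "R t zs k = Suc r" by (cases "R t zs k") (auto simp: R_Suc)
    then have "Tg t (k # r # zs) = Suc y" using Suc.prems by (simp add: R_Suc)
    then have "Tg t' (k # r # zs) = Suc y"
      using step_functionD(4)[OF g, of "k # r # zs" t y t'] that(2,3) by simp
    then show ?case using Suc.IH[OF r] by (simp add: R_Suc)
  qed
  show ?thesis
  proof (rule step_functionI)
    have 1: "recursive (Suc (Suc n)) (\<lambda>ys. Tf (arg 0 (arg 0 ys # tl (tl ys))) (tl (arg 0 ys # tl (tl ys))))"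
      by (intro recursive_compose[OF step_functionD(1)[OF f]] recursive_tuple_Cons recursive_tuple_tl
          recursive_tuple_id rec_intros)
    \<comment> \<open>In the recursion step the tuple consists of \<open>j\<close>,
      \<open>r\<close>, \<open>t\<close>, the recursion argument and then the remaining
      arguments.\<close>
    have 2: "recursive (Suc (Suc (Suc (Suc n))))
      (\<lambda>ys. Tg (arg 0 (arg 0 (tl (tl ys)) # arg 0 ys # (arg 1 ys - 1) # tl (tl (tl (tl ys)))))
          (tl (arg 0 (tl (tl ys)) # arg 0 ys # (arg 1 ys - 1) # tl (tl (tl (tl ys))))))"
      by (intro recursive_compose[OF step_functionD(1)[OF g]] recursive_tuple_Cons recursive_tuple_tl
          recursive_tuple_id rec_intros)
    show "recursive (Suc (Suc n)) (\<lambda>ys. ?T (arg 0 ys) (tl ys))"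
      using 1 2 by (intro rec_intros recursive_rec_nat) simp_all
  next
    fix xs y assume "length xs = Suc n" and e: "evals (PrimRec f g) xs y"
    then obtain k zs where xs: "xs = k # zs" and zs: "length zs = n" by (auto simp: length_Suc_conv)
    have "\<exists>t. R t zs k = Suc y"
      using e[unfolded xs]
    proof (induction k arbitrary: y)
      case 0
      then have "evals f zs y" by (auto elim: evals_PrimRecE)
      then show ?case using step_functionD(2)[OF f zs] by (simp add: R_0)
    next
      case (Suc k)
      then obtain r where r: "evals (PrimRec f g) (k # zs) r" "evals g (k # r # zs) y"
        by (auto elim: evals_PrimRecE)
      obtain t where t: "R t zs k = Suc r" using Suc.IH[OF r(1)] by blast
      obtain t' where t': "Tg t' (k # r # zs) = Suc y"
        using step_functionD(2)[OF g _ r(2)] zs by auto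
      have "R (max t t') zs k = Suc r" using mono[OF t _ zs, of "max t t'"] by simp
      moreover have "Tg (max t t') (k # r # zs) = Suc y"
        using step_functionD(4)[OF g _ t', of "max t t'"] zs by simp
      ultimately show ?case by (intro exI[of _ "max t t'"]) (simp add: R_Suc)
    qed
    then show "\<exists>t. ?T t xs = Suc y" by (simp add: xs R_def cong: if_cong)
  next
    fix xs t y assume "length xs = Suc n" and T: "?T t xs = Suc y"
    then obtain k zs where xs: "xs = k # zs" and zs: "length zs = n" by (auto simp: length_Suc_conv)
    have T': "R t zs k = Suc y" using T by (simp add: xs R_def cong: if_cong)
    then have "evals (PrimRec f g) (k # zs) y"
    proof (induction k arbitrary: y)
      case 0
      then have "evals f zs y" using step_functionD(3)[OF f zs, of t y] by (simp add: R_0)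
      then show ?case by (rule evals_PrimRec_0)
    next
      case (Suc k)
      then obtain r where r: "R t zs k = Suc r" by (cases "R t zs k") (auto simp: R_Suc)
      then have "Tg t (k # r # zs) = Suc y" using Suc.prems by (simp add: R_Suc)
      then have "evals g (k # r # zs) y"
        using step_functionD(3)[OF g, of "k # r # zs" t y] zs by simp
      then show ?case by (rule evals_PrimRec_Suc[OF Suc.IH[OF r]])
    qed
    then show "evals (PrimRec f g) xs y" by (simp add: xs R_def cong: if_cong)
  next
    fix xs t t' y assume "length xs = Suc n" and t: "t \<le> t'" and T: "?T t xs = Suc y"
    then obtain k zs where xs: "xs = k # zs" and zs: "length zs = n" by (auto simp: length_Suc_conv)
    have "R t zs k = Suc y" using T by (simp add: xs R_def cong: if_cong)
    then have "R t' zs k = Suc y" by (rule mono[OF _ t zs])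
    then show "?T t' xs = Suc y" by (simp add: xs R_def cong: if_cong)
  qed
qed

text \<open>At most one summand below is nonzero, since the candidate \<open>m\<close> must be the first zero.\<close>

lemma step_function_Mu:
  assumes f: "step_function f (Suc n) Tf"
  shows "step_function (Mu f) n
    (\<lambda>t xs. \<Sum>m<Suc t. if Tf t (m # xs) = 1 \<and> (\<forall>l<m. 1 < Tf t (l # xs)) then Suc m else 0)"
    (is "step_function _ _ ?T")
proof (rule step_functionI)
  have 1: "recursive (Suc (Suc n))
    (\<lambda>ys. Tf (arg 0 (arg 0 (tl ys) # arg 0 ys # tl (tl ys))) (tl (arg 0 (tl ys) # arg 0 ys # tl (tl ys))))"
    by (intro recursive_compose[OF step_functionD(1)[OF f]] recursive_tuple_Cons recursive_tuple_tl
        recursive_tuple_id rec_intros)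
  have 2: "recursive (Suc (Suc (Suc n)))
    (\<lambda>ys. Tf (arg 0 (arg 0 (tl (tl ys)) # arg 0 ys # tl (tl (tl ys))))
        (tl (arg 0 (tl (tl ys)) # arg 0 ys # tl (tl (tl ys)))))"
    by (intro recursive_compose[OF step_functionD(1)[OF f]] recursive_tuple_Cons recursive_tuple_tl
        recursive_tuple_id rec_intros)
  show "recursive (Suc n) (\<lambda>ys. ?T (arg 0 ys) (tl ys))"
    using 1 2 by (intro rec_intros) simp_all
next
  have T_iff: "?T t xs = Suc y \<longleftrightarrow> y \<le> t \<and> Tf t (y # xs) = 1 \<and> (\<forall>l<y. 1 < Tf t (l # xs))" for t xs y
  proof (cases "\<exists>m\<le>t. Tf t (m # xs) = 1 \<and> (\<forall>l<m. 1 < Tf t (l # xs))")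
    case True
    then obtain m where m: "m \<le> t" "Tf t (m # xs) = 1" "\<forall>l<m. 1 < Tf t (l # xs)" by blast
    \<comment> \<open>Of two different candidates, the smaller would have value 1 and also, by the
      condition on the larger, a value above 1.\<close>
    have uniq: "Tf t (k # xs) = 1 \<and> (\<forall>l<k. 1 < Tf t (l # xs)) \<longleftrightarrow> k = m" for k
    proof
      assume k: "Tf t (k # xs) = 1 \<and> (\<forall>l<k. 1 < Tf t (l # xs))"
      have "\<not> k < m" "\<not> m < k" using k m by auto
      then show "k = m" by simp
    qed (use m in simp)
    show ?thesis using m(1) unfolding uniq by (auto simp del: sum.lessThan_Suc)
  next
    case False
    then have "?T t xs = 0" by auto
    then show ?thesis using False by auto
  qed
  {
    fix xs y assume xs: "length xs = n" and "evals (Mu f) xs y"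
    then have y: "evals f (y # xs) 0" "\<forall>m<y. \<exists>v. evals f (m # xs) (Suc v)"
      by (auto elim: evals_MuE)
    obtain t where t: "Tf t (y # xs) = 1"
      using step_functionD(2)[OF f _ y(1)] xs by auto
    have "\<forall>m\<in>{..<y}. \<exists>s. 1 < Tf s (m # xs)"
    proof
      fix m assume "m \<in> {..<y}"
      then obtain v where "evals f (m # xs) (Suc v)" using y(2) by auto
      then obtain s where "Tf s (m # xs) = Suc (Suc v)" using step_functionD(2)[OF f] xs by force
      then show "\<exists>s. 1 < Tf s (m # xs)" by (intro exI[of _ s]) simp
    qed
    then obtain s where s: "\<forall>m\<in>{..<y}. 1 < Tf (s m) (m # xs)" by (auto dest: bchoice)
    \<comment> \<open>Besides all running times, \<open>T\<close> must bound \<open>y\<close>,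
      because only candidates up to the time are tested.\<close>
    define T where "T = t + y + (\<Sum>m<y. s m)"
    have "1 < Tf T (m # xs)" if "m < y" for m
    proof -
      have "1 < Tf (s m) (m # xs)" using s that by blast
      then obtain v where v: "Tf (s m) (m # xs) = Suc (Suc v)"
        by (auto dest: less_imp_Suc_add)
      have "s m \<le> (\<Sum>m<y. s m)" using that by (intro member_le_sum) auto
      then have "s m \<le> T" by (simp add: T_def)
      with step_functionD(4)[OF f _ v] xs show ?thesis by simp
    qed
    moreover have "Tf T (y # xs) = 1"
      using step_functionD(4)[OF f, of "y # xs" t 0 T] t xs by (simp add: T_def)
    ultimately have "?T T xs = Suc y"
      unfolding T_iff by (auto simp: T_def)
    then show "\<exists>t. ?T t xs = Suc y" ..
  next
    fix xs t y assume xs: "length xs = n" and T: "?T t xs = Suc y"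
    then have 1: "Tf t (y # xs) = Suc 0" "\<forall>l<y. 1 < Tf t (l # xs)" unfolding T_iff by auto
    show "evals (Mu f) xs y"
    proof (rule evals_Mu)
      show "evals f (y # xs) 0" using step_functionD(3)[OF f _ 1(1)] xs by simp
      show "\<forall>m<y. \<exists>v. evals f (m # xs) (Suc v)"
      proof (intro allI impI)
        fix m assume "m < y"
        then have "1 < Tf t (m # xs)" using 1(2) by blast
        then obtain v where "Tf t (m # xs) = Suc (Suc v)"
          by (auto dest: less_imp_Suc_add)
        then show "\<exists>v. evals f (m # xs) (Suc v)" using step_functionD(3)[OF f] xs by (metis length_Cons)
      qed
    qed
  next
    fix xs t t' y assume xs: "length xs = n" and t: "t \<le> t'" and T: "?T t xs = Suc y"
    have mono: "Tf t' (l # xs) = Tf t (l # xs)" if "Tf t (l # xs) \<noteq> 0" for l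
      using step_functionD(4)[OF f, of "l # xs" t _ t'] xs t that by (cases "Tf t (l # xs)") auto
    show "?T t' xs = Suc y"
      using T t unfolding T_iff by (auto simp: mono)
  }
qed

text \<open>Kleene's normal form for each fixed term, by induction on it. It makes the outputs of
  the optimal machine enumerable without coding terms as numbers.\<close>

theorem ex_step_function: "\<exists>T. step_function r n T"
proof (induction r arbitrary: n)
  case Zero
  have "step_function Zero n (\<lambda>t xs. 1)"
  proof (rule step_functionI)
    show "recursive (Suc n) (\<lambda>ys. 1)" by (rule rec_intros)
  qed (auto intro: evals_Zero dest: evals_deterministic[OF evals_Zero])
  then show ?case by blast
next
  case Succ
  have "step_function Succ n (\<lambda>t xs. if n = 1 then Suc (Suc (arg 0 xs)) else 0)"
  proof (rule step_functionI)
    show "recursive (Suc n) (\<lambda>ys. if n = 1 then Suc (Suc (arg 0 (tl ys))) else 0)"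
      by (cases "n = 1"; simp; intro rec_intros)
  next
    fix xs t y assume "length xs = n" "(if n = 1 then Suc (Suc (arg 0 xs)) else 0) = Suc y"
    then obtain x where "xs = [x]" "y = Suc x" by (auto simp: length_Suc_conv split: if_splits)
    then show "evals Succ xs y" by (simp add: evals_Succ)
  qed (auto elim: evals_SuccE split: if_splits)
  then show ?case by blast
next
  case (Proj i)
  have "step_function (Proj i) n (\<lambda>t xs. of_bool (i < n) * Suc (arg i xs))"
  proof (rule step_functionI)
    show "recursive (Suc n) (\<lambda>ys. of_bool (i < n) * Suc (arg i (tl ys)))"
      by (intro rec_intros)
  qed (auto elim: evals_ProjE intro: evals_Proj simp: arg_def split: if_splits)
  then show ?case by blast
next
  case (Comp f gs)
  obtain Tf where Tf: "step_function f (length gs) Tf" using Comp.IH(1) by blast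
  have "\<forall>g\<in>set gs. \<exists>T. step_function g n T" using Comp.IH(2) by blast
  then obtain Tg where "\<forall>g\<in>set gs. step_function g n (Tg g)" by (auto dest: bchoice)
  with Tf show ?case by (blast intro: step_function_Comp)
next
  case (PrimRec f g)
  show ?case
  proof (cases n)
    case 0
    have "step_function (PrimRec f g) n (\<lambda>t xs. 0)"
    proof (rule step_functionI)
      show "recursive (Suc n) (\<lambda>ys. 0)" by (rule rec_intros)
    qed (use 0 in \<open>auto elim: evals_PrimRecE\<close>)
    then show ?thesis by blast
  next
    case (Suc m)
    then show ?thesis using PrimRec.IH(1)[of m] PrimRec.IH(2)[of "Suc (Suc m)"]
      by (blast intro: step_function_PrimRec)
  qed
next
  case (Mu f)
  then show ?case by (blast intro: step_function_Mu)
qed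

section \<open>Ceilings of multiples of a computable real\<close>

lemma total_recursive_imp_recursive: "total_recursive f \<Longrightarrow> recursive 1 (\<lambda>xs. f (arg 0 xs))"
  unfolding total_recursive_def recursive_def by (auto simp: length_Suc_conv) fastforce

lemma decidable_less_mult_rat:
  "decidable 2 (\<lambda>xs. real (arg 0 xs) < real p / real (Suc q) * real (arg 1 xs))"
proof -
  have "real z < real p / real (Suc q) * real j \<longleftrightarrow> z * Suc q < p * j" for z j
  proof -
    have "real z < real p / real (Suc q) * real j \<longleftrightarrow> real z * real (Suc q) < real p * real j"
      by (simp add: pos_less_divide_eq)
    also have "\<dots> \<longleftrightarrow> z * Suc q < p * j" by (simp only: of_nat_mult[symmetric] of_nat_less_iff)
    finally show ?thesis .
  qed
  then show ?thesis by (simp only:) (intro rec_intros)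
qed

text \<open>For \<open>j > 0\<close> the product \<open>t * j\<close> is never an integer, so a
  sufficiently fine approximation separates it from \<open>z\<close>; the procedure searches for
  such a precision.\<close>

lemma decidable_less_mult_irrat:
  assumes t: "computable_real t" "t \<notin> \<rat>"
  shows "decidable 2 (\<lambda>xs. real (arg 0 xs) < t * real (arg 1 xs))"
proof -
  obtain a b c where rec: "total_recursive a" "total_recursive b" "total_recursive c"
    and approx: "\<And>n. \<bar>t - (real (a n) - real (b n)) / real (c n + 1)\<bar> \<le> 1 / 2 ^ n"
    using t(1) unfolding computable_real_def by blast
  note rec' = rec[THEN total_recursive_imp_recursive, THEN recursive_unary]
  \<comment> \<open>\<open>below\<close> and \<open>above\<close> are the comparisons in
    \<open>below_iff\<close> and \<open>above_iff\<close>, multiplied by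
    \<open>Suc (c N) * 2 ^ N\<close> and rearranged so that no subtraction of natural numbers
    occurs.\<close>
  define below where "below N z j \<longleftrightarrow> (z * Suc (c N) + b N * j) * 2 ^ N + j * Suc (c N) < a N * j * 2 ^ N"
    for N z j
  define above where "above N z j \<longleftrightarrow> a N * j * 2 ^ N + j * Suc (c N) < (z * Suc (c N) + b N * j) * 2 ^ N"
    for N z j
  define q where "q N = (real (a N) - real (b N)) / real (c N + 1)" for N
  have q_mult: "(q N * j) * (real (c N + 1) * 2 ^ N) = (real (a N) - real (b N)) * j * 2 ^ N"
    "(j / 2 ^ N) * (real (c N + 1) * 2 ^ N) = j * real (c N + 1)" for N and j :: real
    by (simp_all add: q_def)
  have below_iff: "below N z j \<longleftrightarrow> real z < q N * j - j / 2 ^ N" for N z j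
  proof -
    have "below N z j \<longleftrightarrow> real ((z * Suc (c N) + b N * j) * 2 ^ N + j * Suc (c N)) < real (a N * j * 2 ^ N)"
      unfolding below_def of_nat_less_iff ..
    also have "\<dots> \<longleftrightarrow> real z * (real (c N + 1) * 2 ^ N) < (q N * j - j / 2 ^ N) * (real (c N + 1) * 2 ^ N)"
      unfolding left_diff_distrib[of "q N * j"] distrib_right[of "q N * j"] q_mult
      by (simp add: algebra_simps)
    also have "\<dots> \<longleftrightarrow> real z < q N * j - j / 2 ^ N"
      by (intro mult_less_cancel_right_pos) simp
    finally show ?thesis .
  qed
  have above_iff: "above N z j \<longleftrightarrow> q N * j + j / 2 ^ N < real z" for N z j
  proof -
    have "above N z j \<longleftrightarrow> real (a N * j * 2 ^ N + j * Suc (c N)) < real ((z * Suc (c N) + b N * j) * 2 ^ N)"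
      unfolding above_def of_nat_less_iff ..
    also have "\<dots> \<longleftrightarrow> (q N * j + j / 2 ^ N) * (real (c N + 1) * 2 ^ N) < real z * (real (c N + 1) * 2 ^ N)"
      unfolding left_diff_distrib[of "q N * j"] distrib_right[of "q N * j"] q_mult
      by (simp add: algebra_simps)
    also have "\<dots> \<longleftrightarrow> q N * j + j / 2 ^ N < real z"
      by (intro mult_less_cancel_right_pos) simp
    finally show ?thesis .
  qed
  have close: "\<bar>t * j - q N * j\<bar> \<le> j / 2 ^ N" for N and j :: nat
  proof -
    have "\<bar>t * j - q N * j\<bar> = \<bar>t - q N\<bar> * j" by (simp add: abs_mult flip: left_diff_distrib)
    also have "\<dots> \<le> 1 / 2 ^ N * j" by (intro mult_right_mono) (use approx[of N] in \<open>simp_all add: q_def\<close>)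
    finally show ?thesis by simp
  qed
  have ex: "\<exists>N. j = 0 \<or> below N z j \<or> above N z j" for z j :: nat
  proof (cases "j = 0")
    case False
    have "t * j \<noteq> z"
    proof
      assume "t * j = z"
      then have "t = real z / real j" using False by (simp add: field_simps)
      then show False using t(2) by (simp add: Rats_divide)
    qed
    \<comment> \<open>The approximation error and the safety margin are each at most
      \<open>j / 2 ^ N\<close>; twice that must stay below the distance from \<open>t * j\<close> to
      \<open>z\<close>.\<close>
    then have "0 < \<bar>t * j - z\<bar> / (2 * j)" using False by simp
    then obtain N where N: "(1 / 2) ^ N < \<bar>t * j - z\<bar> / (2 * j)"
      using real_arch_pow_inv[of _ "1 / 2"] by auto
    then have "2 * (j / 2 ^ N) < \<bar>t * j - z\<bar>"
      using False by (simp add: field_simps power_divide)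
    then have "below N z j \<or> above N z j"
      unfolding below_iff above_iff using close[of j N] by linarith
    then show ?thesis by blast
  qed auto
  define prec where "prec z j = (LEAST N. j = 0 \<or> below N z j \<or> above N z j)" for z j
  have "real z < t * j \<longleftrightarrow> 0 < j \<and> below (prec z j) z j" for z j
  proof (cases "j = 0")
    case False
    then have "below (prec z j) z j \<or> above (prec z j) z j"
      using LeastI_ex[OF ex[of j z]] by (simp add: prec_def)
    then show ?thesis
      using False close[of j "prec z j"] unfolding below_iff above_iff by auto
  qed simp
  then show ?thesis
    unfolding prec_def below_def above_def using ex[unfolded below_def above_def]
    by (simp only:) (intro rec_intros rec', blast)
qed

text \<open>A ceiling counts the natural numbers strictly below the product, and by
  \<open>t < 1\<close> all of these are below \<open>j\<close>. The case distinction on rationality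
  need not be effective, as only the existence of a term is claimed.\<close>

lemma recursive_nat_ceiling_mult:
  assumes t: "computable_real t" and "0 < t" "t < 1"
  shows "recursive 1 (\<lambda>xs. nat \<lceil>t * real (arg 0 xs)\<rceil>)"
proof -
  have "decidable 2 (\<lambda>xs. real (arg 0 xs) < t * real (arg 1 xs))"
  proof (cases "t \<in> \<rat>")
    case True
    then obtain p q :: nat where "q \<noteq> 0" "t = real p / real q"
      using Rats_abs_nat_div_natE[OF True] assms(2) by (metis abs_of_pos)
    then show ?thesis using decidable_less_mult_rat[of p "q - 1"] by simp
  next
    case False
    then show ?thesis using t by (intro decidable_less_mult_irrat)
  qed
  note dec = decidable_binary[of "\<lambda>z j. real z < t * real j", OF this]
  have "nat \<lceil>t * real j\<rceil> = (\<Sum>z<j. of_bool (real z < t * real j))" for j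
  proof -
    have "(\<Sum>z<j. of_bool (real z < t * real j)) = card {z. z < j \<and> real z < t * real j}"
      by (simp add: of_bool_def sum.If_cases Int_def)
    also have "{z. z < j \<and> real z < t * real j} = {..<nat \<lceil>t * real j\<rceil>}"
    proof -
      have 1: "t * real j \<le> real j" using assms by (simp add: mult_left_le_one_le)
      have "real z < t * real j \<longleftrightarrow> z < nat \<lceil>t * real j\<rceil>" for z
        by linarith
      moreover have "z < j" if "real z < t * real j" for z
        using that 1 by linarith
      ultimately show ?thesis by auto
    qed
    finally show ?thesis by simp
  qed
  then show ?thesis by (simp only:) (intro rec_intros dec)
qed

section \<open>Strings and searches\<close>

text \<open>The strings of length \<open>n\<close> occupy the codes from \<open>2 ^ n - 1\<close> to
  \<open>2 ^ Suc n - 2\<close>; hence \<open>Suc\<close> of a code minus \<open>2 ^ n\<close> is the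
  index of the string among those of its length.\<close>

lemma str_code_bounds: "2 ^ length x \<le> Suc (str_code x)" "Suc (str_code x) < 2 ^ Suc (length x)"
  by (induction x) auto

definition code_length :: "nat \<Rightarrow> nat" where
  "code_length c = (LEAST l. Suc c < 2 ^ Suc l)"

lemma recursive_code_length [rec_intros]:
  assumes "recursive n f" shows "recursive n (\<lambda>xs. code_length (f xs))"
proof (rule recursive_unary[OF _ assms])
  have "\<exists>l. Suc c < 2 ^ Suc l" for c
    by (metis bij_is_surj bij_str_code str_code_bounds(2) surjD)
  then show "recursive 1 (\<lambda>xs. code_length (arg 0 xs))"
    unfolding code_length_def by (intro rec_intros)
qed

lemma code_length_str_code [simp]: "code_length (str_code x) = length x"
  unfolding code_length_def
proof (rule Least_equality)
  show "Suc (str_code x) < 2 ^ Suc (length x)" by (rule str_code_bounds)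
next
  fix l assume "Suc (str_code x) < 2 ^ Suc l"
  with str_code_bounds(1)[of x] have "(2::nat) ^ length x < 2 ^ Suc l" by linarith
  then show "length x \<le> l" by (simp only: power_strict_increasing_iff less_Suc_eq_le one_less_numeral_iff semiring_norm)
qed

lemma str_code_inv [simp]: "str_code (inv str_code c) = c"
  by (simp add: bij_is_surj bij_str_code surj_f_inv_f)

lemma inv_str_code [simp]: "inv str_code (str_code x) = x"
  by (simp add: bij_is_inj bij_str_code)

text \<open>\<open>v + 2 ^ n - 1\<close> is the code of string number \<open>v\<close> of length
  \<open>n\<close>; the outputs below are produced in this form.\<close>

lemma length_inv_str_code:
  assumes "v < 2 ^ n" shows "length (inv str_code (v + 2 ^ n - 1)) = n"
proof -
  let ?x = "inv str_code (v + 2 ^ n - 1)"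
  have c: "Suc (str_code ?x) = v + 2 ^ n" by simp
  have "(2::nat) ^ length ?x < 2 ^ Suc n" "(2::nat) ^ n < 2 ^ Suc (length ?x)"
    using str_code_bounds[of ?x] assms unfolding c by auto
  then show ?thesis
    by (simp only: power_strict_increasing_iff less_Suc_eq_le one_less_numeral_iff semiring_norm)
qed

text \<open>The extraction functions and the describing machine all have this form: search for a
  witness, then apply a total function to it and the input.\<close>

lemma partial_computable_search:
  assumes P: "decidable 2 (\<lambda>xs. P (arg 0 xs) (arg 1 xs))"
    and h: "recursive 2 (\<lambda>xs. h (arg 0 xs) (arg 1 xs))"
  shows "partial_computable (\<lambda>x. if \<exists>z. P z (str_code x)
      then Some (inv str_code (h (LEAST z. P z (str_code x)) (str_code x))) else None)"
proof -
  obtain rP where "\<And>xs. length xs = 2 \<Longrightarrow> evals rP xs (of_bool (\<not> P (arg 0 xs) (arg 1 xs)))"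
    using decidable_not[OF P] by (auto simp: decidable_def recursive_def)
  from this[of "[z, c]" for z c] have "evals rP [z, c] (of_bool (\<not> P z c))" for z c by simp
  note Mu = evals_Mu_iff[of rP, OF this]
  obtain rh where "\<And>xs. length xs = 2 \<Longrightarrow> evals rh xs (h (arg 0 xs) (arg 1 xs))"
    using h by (auto simp: recursive_def)
  from this[of "[z, c]" for z c] have "evals rh [z, c] (h z c)" for z c by simp
  then have rh: "evals rh [z, c] y \<longleftrightarrow> y = h z c" for z c y
    using evals_deterministic by blast
  have Proj: "evals (Proj 0) [c] y \<longleftrightarrow> y = c" for c y
    using evals_Proj[of 0 "[c]"] evals_deterministic[of "Proj 0" "[c]"] by auto
  have ev: "evals (Comp rh [Mu rP, Proj 0]) [c] y \<longleftrightarrow>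
      (\<exists>z. P z c \<and> (\<forall>w<z. \<not> P w c) \<and> y = h z c)" for c y
    by (subst evals.simps) (auto simp: list_all2_Cons1 Mu rh Proj)
  have least: "P z c \<and> (\<forall>w<z. \<not> P w c) \<longleftrightarrow> (\<exists>z. P z c) \<and> z = (LEAST z. P z c)" for z c
    by (metis LeastI_ex Least_equality not_less_Least linorder_not_less)
  show ?thesis
    unfolding partial_computable_def
  proof (intro exI allI)
    fix x y
    show "((if \<exists>z. P z (str_code x) then Some (inv str_code (h (LEAST z. P z (str_code x)) (str_code x)))
        else None) = Some y) \<longleftrightarrow> evals (Comp rh [Mu rP, Proj 0]) [str_code x] (str_code y)"
      unfolding ev conj_assoc[symmetric] least by (auto; metis str_code_inv inv_str_code)
  qed
qed

section \<open>Rounds of reassignment\<close>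

definition rank :: "(nat \<Rightarrow> bool) \<Rightarrow> nat \<Rightarrow> nat" where
  "rank E z = (\<Sum>v<z. of_bool (E v))"

text \<open>\<open>w\<close> is the time at which the object \<open>z mod M\<close> entered the
  round whose entrances are \<open>E\<close>; its value there is its rank modulo \<open>N\<close>.
  Bounding \<open>w\<close> by \<open>z\<close> keeps this decidable.\<close>

definition spoiled :: "nat \<Rightarrow> nat \<Rightarrow> (nat \<Rightarrow> nat \<Rightarrow> bool) \<Rightarrow> (nat \<Rightarrow> bool) \<Rightarrow> nat \<Rightarrow> bool" where
  "spoiled M N hit E z \<longleftrightarrow> (\<exists>w<Suc z. w mod M = z mod M \<and> E w \<and> hit z (rank E w mod N))"

text \<open>A time \<open>z\<close> also names the object \<open>z mod M\<close>. Object \<open>x < M\<close> enters round \<open>i\<close> at the unique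
  time \<open>z\<close> with \<open>z mod M = x\<close> and \<open>event M N hit i z\<close>, if there is one; in round \<open>i\<close> the entering
  objects receive the values \<open>0, \<dots>, N - 1\<close> cyclically, in order of entrance. An object proceeds to
  round \<open>i + 1\<close> at the first time at which its value is hit.\<close>

primrec event :: "nat \<Rightarrow> nat \<Rightarrow> (nat \<Rightarrow> nat \<Rightarrow> bool) \<Rightarrow> nat \<Rightarrow> nat \<Rightarrow> bool" where
  "event M N hit 0 = (\<lambda>z. z < M)"
| "event M N hit (Suc i) = (\<lambda>z. spoiled M N hit (event M N hit i) z \<and>
     (\<forall>u<z. u mod M = z mod M \<longrightarrow> \<not> spoiled M N hit (event M N hit i) u))"

lemma rank_eq_card: "rank E z = card {v. v < z \<and> E v}"
  by (simp add: rank_def of_bool_def sum.If_cases Int_def)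

lemma rank_less: "E z \<Longrightarrow> z < w \<Longrightarrow> rank E z < rank E w"
  unfolding rank_eq_card by (rule psubset_card_mono) auto

lemma rank_inj: "E z \<Longrightarrow> E w \<Longrightarrow> rank E z = rank E w \<Longrightarrow> z = w"
  by (metis rank_less less_irrefl linorder_neqE_nat)

lemma rank_less_card: "finite {v. E v} \<Longrightarrow> E z \<Longrightarrow> rank E z < card {v. E v}"
  unfolding rank_eq_card by (rule psubset_card_mono) auto

lemma event_unique:
  assumes "event M N hit i z" "event M N hit i w" "z mod M = w mod M"
  shows "z = w"
proof (cases i)
  case 0
  then show ?thesis using assms by simp
next
  case (Suc j)
  then have "\<not> z < w" "\<not> w < z" using assms by auto
  then show ?thesis by simp
qed

lemma finite_events:
  assumes "0 < M" shows "finite {z. event M N hit i z}"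
proof (rule finite_imageD)
  show "finite ((\<lambda>z. z mod M) ` {z. event M N hit i z})"
    by (rule finite_subset[of _ "{..<M}"]) (use assms in auto)
  show "inj_on (\<lambda>z. z mod M) {z. event M N hit i z}"
    by (auto intro: inj_onI event_unique)
qed

text \<open>An object that proceeds is determined by its hit value and by the lap of the cyclic
  assignment in which it received that value.\<close>

lemma card_event_Suc:
  assumes "0 < M" "0 < N"
  shows "card {z. event M N hit (Suc i) z} \<le>
    card {v. v < N \<and> (\<exists>t. hit t v)} * Suc (card {z. event M N hit i z} div N)"
proof -
  let ?E = "event M N hit i" and ?H = "{v. v < N \<and> (\<exists>t. hit t v)}"
  have "\<exists>w. w mod M = z mod M \<and> ?E w \<and> hit z (rank ?E w mod N)" if "event M N hit (Suc i) z" for z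
    using that by (auto simp: spoiled_def)
  then obtain w where w: "\<And>z. event M N hit (Suc i) z \<Longrightarrow>
      w z mod M = z mod M \<and> ?E (w z) \<and> hit z (rank ?E (w z) mod N)"
    by metis
  let ?f = "\<lambda>z. (rank ?E (w z) mod N, rank ?E (w z) div N)"
  have "card {z. event M N hit (Suc i) z} \<le> card (?H \<times> {..card {z. ?E z} div N})"
  proof (rule card_inj_on_le)
    show "inj_on ?f {z. event M N hit (Suc i) z}"
    proof (rule inj_onI)
      fix y z assume y: "y \<in> {z. event M N hit (Suc i) z}" and z: "z \<in> {z. event M N hit (Suc i) z}"
        and eq: "?f y = ?f z"
      have "rank ?E (w y) = rank ?E (w z)" using eq by (metis Pair_inject div_mult_mod_eq)
      then have "w y = w z" using w y z by (blast intro: rank_inj)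
      then show "y = z" using w y z by (metis event_unique mem_Collect_eq)
    qed
    have "rank ?E (w z) div N \<le> card {z. ?E z} div N" if "event M N hit (Suc i) z" for z
      using rank_less_card[OF finite_events[OF assms(1)]] w[OF that] by (intro div_le_mono less_imp_le) blast
    then show "?f ` {z. event M N hit (Suc i) z} \<subseteq> ?H \<times> {..card {z. ?E z} div N}"
      using w assms(2) by (auto simp del: event.simps)
  qed (use assms in auto)
  then show ?thesis by (simp add: card_cartesian_product)
qed

lemma ex_event_Suc:
  assumes "0 < M" "event M N hit i w" "hit t (rank (event M N hit i) w mod N)"
    and mono: "\<And>t t' v. t \<le> t' \<Longrightarrow> hit t v \<Longrightarrow> hit t' v"
  shows "\<exists>z. event M N hit (Suc i) z \<and> z mod M = w mod M"
proof -
  let ?P = "\<lambda>z. z mod M = w mod M \<and> spoiled M N hit (event M N hit i) z"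
  \<comment> \<open>The time \<open>w + t * M\<close> names the same object as \<open>w\<close> and
    is late enough for both the entrance and the hit.\<close>
  have "t \<le> w + t * M" using assms(1) by (simp add: trans_le_add2)
  from mono[OF this assms(3)] have "?P (w + t * M)"
    unfolding spoiled_def using assms(2) by (intro conjI exI[of _ w]) simp_all
  then have "\<exists>z. ?P z" ..
  then obtain z where z: "?P z" "\<forall>u<z. \<not> ?P u"
    using exists_least_iff[of ?P] by blast
  then have "event M N hit (Suc i) z" by simp
  then show ?thesis using z(1) by blast
qed

text \<open>With \<open>n = s + D\<close> a round divides the number of objects by
  \<open>2 ^ D\<close> and adds at most \<open>2 ^ s\<close>. The hypothesis on \<open>m\<close>
  lets \<open>k\<close> rounds bring the main term down to \<open>2 ^ (s + k)\<close>.\<close>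

lemma card_event_le:
  assumes hits: "card {v. v < 2 ^ n \<and> (\<exists>t. hit t v)} \<le> 2 ^ s"
    and n: "n = s + D" and m: "m \<le> k * D + s + k" and "i \<le> k"
  shows "card {z. event (2 ^ m) (2 ^ n) hit i z} \<le> 2 ^ ((k - i) * D + s + k) + i * 2 ^ s"
  using \<open>i \<le> k\<close>
proof (induction i)
  case 0
  have "{z. z < (2::nat) ^ m} = {..<2 ^ m}" by auto
  then have "card {z. z < (2::nat) ^ m} = 2 ^ m" by simp
  then show ?case using m by simp
next
  case (Suc i)
  let ?c = "\<lambda>i. card {z. event (2 ^ m) (2 ^ n) hit i z}"
  have "k - i = Suc (k - Suc i)" using Suc.prems by simp
  then have exponent: "(k - i) * D + s + k = D + ((k - Suc i) * D + s + k)" by simp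
  have "?c (Suc i) \<le> 2 ^ s * Suc (?c i div 2 ^ n)"
    by (rule order_trans[OF card_event_Suc mult_le_mono1[OF hits]]) simp_all
  \<comment> \<open>Multiplying by \<open>2 ^ D\<close> turns the factor \<open>2 ^ s\<close> into
    \<open>2 ^ n\<close>, which cancels the division.\<close>
  then have "2 ^ D * ?c (Suc i) \<le> 2 ^ D * (2 ^ s * Suc (?c i div 2 ^ n))"
    by (rule mult_le_mono2)
  also have "\<dots> = 2 ^ n * (?c i div 2 ^ n) + 2 ^ n"
    by (simp add: n power_add algebra_simps)
  also have "\<dots> \<le> ?c i + 2 ^ n" by (intro add_right_mono times_div_less_eq_dividend)
  also have "\<dots> \<le> 2 ^ ((k - i) * D + s + k) + i * 2 ^ s + 2 ^ n"
    by (intro add_right_mono Suc.IH[OF Suc_leD[OF Suc.prems]])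
  also have "\<dots> \<le> 2 ^ ((k - i) * D + s + k) + i * (2 ^ D * 2 ^ s) + 2 ^ n"
    by (intro add_mono mult_le_mono2) simp_all
  also have "\<dots> = 2 ^ D * (2 ^ ((k - Suc i) * D + s + k) + Suc i * 2 ^ s)"
    unfolding exponent by (simp add: n power_add algebra_simps)
  finally show ?case by (rule mult_left_le_imp_le) simp
qed

lemma decidable_ternary:
  assumes "decidable 3 (\<lambda>xs. P (arg 0 xs) (arg 1 xs) (arg 2 xs))" "recursive n a" "recursive n b" "recursive n c"
  shows "decidable n (\<lambda>xs. P (a xs) (b xs) (c xs))"
proof -
  have "arg 2 [x, y, z] = z" for x y z by (simp add: arg_def)
  then show ?thesis
    using recursive_compose[OF assms(1)[unfolded decidable_def], of n "\<lambda>xs. [a xs, b xs, c xs]"] assms(2-)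
    by (simp add: recursive_tuple_Cons recursive_tuple_Nil numeral_3_eq_3 decidable_def)
qed

text \<open>The procedure is built separately for each \<open>i\<close>, by induction, but is
  uniform in the parameter of \<open>M\<close>, \<open>N\<close> and \<open>hit\<close>, later the
  input length.\<close>

lemma decidable_event:
  assumes M: "recursive 1 (\<lambda>xs. M (arg 0 xs))" and N: "recursive 1 (\<lambda>xs. N (arg 0 xs))"
    and hit: "decidable 3 (\<lambda>xs. hit (arg 0 xs) (arg 1 xs) (arg 2 xs))"
  shows "decidable 2 (\<lambda>xs. event (M (arg 0 xs)) (N (arg 0 xs)) (hit (arg 0 xs)) i (arg 1 xs))"
proof (induction i)
  case 0
  show ?case unfolding event.simps by (intro rec_intros recursive_unary[OF M])
next
  case (Suc i)
  note IH = decidable_binary[of "\<lambda>m z. event (M m) (N m) (hit m) i z", OF Suc.IH]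
  show ?case
    unfolding event.simps spoiled_def rank_def
    by (intro rec_intros recursive_unary[OF M] recursive_unary[OF N] decidable_ternary[OF hit] IH)
qed

section \<open>Lengths and complexities\<close>

definition ceil_mult :: "real \<Rightarrow> nat \<Rightarrow> nat" where
  "ceil_mult \<alpha> j = nat \<lceil>\<alpha> * real j\<rceil>"

text \<open>The unique \<open>n\<close> with \<open>m = \<lfloor>(\<beta> / \<alpha>) * n\<rfloor>\<close>, if there is one.\<close>

definition out_length :: "real \<Rightarrow> nat \<Rightarrow> nat \<Rightarrow> nat" where
  "out_length \<alpha> k m = (m + ceil_mult \<alpha> (m * (k - 1)) + (k - 1)) div k"

lemma ceil_mult_bounds:
  assumes "0 < \<alpha>"
  shows "\<alpha> * real j \<le> real (ceil_mult \<alpha> j)" "real (ceil_mult \<alpha> j) < \<alpha> * real j + 1"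
proof -
  have "0 \<le> \<alpha> * real j" using assms by simp
  then show "\<alpha> * real j \<le> real (ceil_mult \<alpha> j)" "real (ceil_mult \<alpha> j) < \<alpha> * real j + 1"
    unfolding ceil_mult_def by linarith+
qed

lemma ceil_mult_le_iff: "ceil_mult \<alpha> j \<le> z \<longleftrightarrow> \<alpha> * real j \<le> real z"
  unfolding ceil_mult_def by linarith

text \<open>Both bounds rest on \<open>k * out_length \<alpha> k m\<close> being at least
  \<open>m + (k - 1) * \<alpha> * m\<close>. The first makes the difference of the lengths a true
  subtraction; the second is the hypothesis on \<open>m\<close> in \<open>card_event_le\<close>, its
  last summand paying for the rounding.\<close>

lemma out_length_bounds:
  assumes "0 < \<alpha>" "\<alpha> < 1" "1 \<le> k"
  shows "ceil_mult \<alpha> m \<le> out_length \<alpha> k m"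
    and "m \<le> k * (out_length \<alpha> k m - ceil_mult \<alpha> m) + ceil_mult \<alpha> m + k"
proof -
  define L s where "L = out_length \<alpha> k m" and "s = ceil_mult \<alpha> m"
  have "m + ceil_mult \<alpha> (m * (k - 1)) + (k - 1) < k * Suc L"
    using dividend_less_times_div[of k "m + ceil_mult \<alpha> (m * (k - 1)) + (k - 1)"] assms(3)
    by (simp add: L_def out_length_def)
  then have "m + ceil_mult \<alpha> (m * (k - 1)) \<le> k * L" using assms(3) by simp
  then have "real m + real (ceil_mult \<alpha> (m * (k - 1))) \<le> real (k * L)"
    by (metis of_nat_add of_nat_le_iff)
  then have L: "real m + (real k - 1) * (\<alpha> * real m) \<le> real k * real L"
    using ceil_mult_bounds(1)[OF assms(1), of "m * (k - 1)"]
    unfolding of_nat_mult of_nat_diff[OF assms(3)] by (simp add: algebra_simps)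
  have "\<alpha> * real m \<le> 1 * real m" using assms by (intro mult_right_mono) auto
  then have "real k * (\<alpha> * real m) \<le> real k * real L"
    using L by (simp add: algebra_simps)
  then have "\<alpha> * real m \<le> real L" using assms(3) by simp
  then show sL: "ceil_mult \<alpha> m \<le> out_length \<alpha> k m"
    by (simp add: ceil_mult_le_iff L_def)
  have "(real k - 1) * (real s - 1) \<le> (real k - 1) * (\<alpha> * real m)"
    using ceil_mult_bounds(2)[OF assms(1), of m] assms(3) by (intro mult_left_mono) (auto simp: s_def)
  then have "real m \<le> real k * (real L - real s) + real s + real k"
    using L by (simp add: algebra_simps)
  also have "\<dots> = real (k * (L - s) + s + k)"
    using sL by (simp add: L_def s_def of_nat_diff)
  finally show "m \<le> k * (out_length \<alpha> k m - ceil_mult \<alpha> m) + ceil_mult \<alpha> m + k"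
    unfolding L_def s_def of_nat_le_iff .
qed

text \<open>As \<open>\<beta> / \<alpha> = k / (1 + (k - 1) * \<alpha>)\<close>, the floor condition
  confines \<open>k * n\<close> to a half-open interval of length
  \<open>1 + (k - 1) * \<alpha> \<le> k\<close>, which holds at most one multiple of
  \<open>k\<close>. Thus the output length is computable from the input length.\<close>

lemma length_eq_out_length:
  assumes \<alpha>: "0 < \<alpha>" "\<alpha> < 1" and k: "1 \<le> k" and \<beta>: "\<beta> = real k * \<alpha> / (1 + (real k - 1) * \<alpha>)"
    and m: "int m = \<lfloor>(\<beta> / \<alpha>) * real n\<rfloor>"
  shows "n = out_length \<alpha> k m" and "\<beta> * real n \<le> \<alpha> * real m + 1"
proof -
  have pos: "0 < 1 + (real k - 1) * \<alpha>" using \<alpha> k by (simp add: add_pos_nonneg)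
  have r: "\<beta> / \<alpha> = real k / (1 + (real k - 1) * \<alpha>)" using \<alpha> by (simp add: \<beta>)
  have lo: "real m \<le> (\<beta> / \<alpha>) * real n" and hi: "(\<beta> / \<alpha>) * real n < real m + 1"
    using m by linarith+
  have "\<beta> * real n = \<alpha> * ((\<beta> / \<alpha>) * real n)" using \<alpha> by simp
  also have "\<dots> \<le> \<alpha> * (real m + 1)" using hi \<alpha> by (intro mult_left_mono) auto
  also have "\<dots> \<le> \<alpha> * real m + 1" using \<alpha> by (simp add: algebra_simps)
  finally show "\<beta> * real n \<le> \<alpha> * real m + 1" .
  have lo': "real m * (1 + (real k - 1) * \<alpha>) \<le> real k * real n"
    using lo pos unfolding r by (simp add: pos_le_divide_eq mult.commute)
  have hi': "real k * real n < (real m + 1) * (1 + (real k - 1) * \<alpha>)"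
    using hi pos unfolding r by (simp add: pos_divide_less_eq mult.commute)
  have mk: "real (m * (k - 1)) = real m * (real k - 1)" using k by (simp only: of_nat_mult of_nat_diff of_nat_1)
  have "(real k - 1) * \<alpha> \<le> (real k - 1) * 1" using \<alpha> k by (intro mult_left_mono) auto
  then have up: "real k * real n < real m + \<alpha> * real (m * (k - 1)) + real k"
    unfolding mk using hi' by (simp add: algebra_simps)
  have down: "real m + \<alpha> * real (m * (k - 1)) \<le> real (k * n)"
    unfolding mk using lo' by (simp add: algebra_simps)
  moreover have "0 \<le> \<alpha> * real (m * (k - 1))" using \<alpha> by simp
  ultimately have "real m \<le> real (k * n)" by linarith
  then have "m \<le> k * n" by (simp only: of_nat_le_iff)
  then have "ceil_mult \<alpha> (m * (k - 1)) \<le> k * n - m"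
    unfolding ceil_mult_le_iff using down by (simp add: of_nat_diff)
  then have "m + ceil_mult \<alpha> (m * (k - 1)) \<le> k * n" using \<open>m \<le> k * n\<close> by simp
  moreover have "real (k * n) < real (m + ceil_mult \<alpha> (m * (k - 1)) + k)"
    using up ceil_mult_bounds(1)[OF \<alpha>(1), of "m * (k - 1)"] by simp
  then have "k * n < m + ceil_mult \<alpha> (m * (k - 1)) + k" by (simp only: of_nat_less_iff)
  ultimately show "n = out_length \<alpha> k m"
    unfolding out_length_def using k
    by (intro div_nat_eqI[symmetric]) (auto simp: algebra_simps)
qed

lemma complexity_lessD:
  assumes "complexity U y < enat s" shows "\<exists>p. U p = Some y \<and> length p < s"
  using assms by (auto simp: complexity_def INF_less_iff)

lemma complexity_le: "M p = Some x \<Longrightarrow> complexity M x \<le> enat (length p)"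
  unfolding complexity_def by (rule INF_lower) simp

text \<open>Codes below \<open>2 ^ s - 1\<close> are the programs of fewer than \<open>s\<close>
  bits, and each has at most one output. The equation with \<open>T\<close> says that the output is
  string number \<open>v\<close> of length \<open>n\<close>.\<close>

lemma card_hits_le:
  assumes T: "step_function r 1 T"
  shows "card {v. v < 2 ^ n \<and> (\<exists>t. \<exists>p<2 ^ s - 1. T t [p] = v + 2 ^ n)} \<le> 2 ^ s"
proof -
  \<comment> \<open>Programs without output only enlarge this image.\<close>
  have "v \<in> (\<lambda>p. Suc (THE y. evals r [p] y) - 2 ^ n) ` {..<2 ^ s - 1}"
    if "T t [p] = v + 2 ^ n" "p < 2 ^ s - 1" for v t p
  proof -
    have "T t [p] = Suc (v + 2 ^ n - 1)" using that by simp
    then have "evals r [p] (v + 2 ^ n - 1)" using step_functionD(3)[OF T, of "[p]"] by simp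
    then have "(THE y. evals r [p] y) = v + 2 ^ n - 1" by (blast intro: evals_deterministic)
    then have "v = Suc (THE y. evals r [p] y) - 2 ^ n" by simp
    then show ?thesis using that(2) by blast
  qed
  then have "{v. v < 2 ^ n \<and> (\<exists>t. \<exists>p<2 ^ s - 1. T t [p] = v + 2 ^ n)} \<subseteq>
      (\<lambda>p. Suc (THE y. evals r [p] y) - 2 ^ n) ` {..<2 ^ s - 1}" by blast
  then have "card {v. v < 2 ^ n \<and> (\<exists>t. \<exists>p<2 ^ s - 1. T t [p] = v + 2 ^ n)} \<le>
      card ((\<lambda>p. Suc (THE y. evals r [p] y) - 2 ^ n) ` {..<2 ^ s - 1::nat})"
    by (rule card_mono[rotated]) simp
  also have "\<dots> \<le> card {..<2 ^ s - 1::nat}" by (rule card_image_le) simp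
  finally show ?thesis by simp
qed

text \<open>The inequality between the ceilings gives
  \<open>\<alpha> * m < \<alpha> * l + 1\<close>, so \<open>m\<close> exceeds the least such
  \<open>l\<close> by less than \<open>1 / \<alpha>\<close>. Hence \<open>K\<close> bits of advice
  recover \<open>m\<close> from \<open>ceil_mult \<alpha> m\<close>.\<close>

lemma least_preimage_close:
  assumes "0 < \<alpha>" "1 / \<alpha> \<le> 2 ^ K"
  shows "(LEAST l. ceil_mult \<alpha> m \<le> ceil_mult \<alpha> l) \<le> m"
    and "m - (LEAST l. ceil_mult \<alpha> m \<le> ceil_mult \<alpha> l) < 2 ^ K"
proof -
  let ?l = "LEAST l. ceil_mult \<alpha> m \<le> ceil_mult \<alpha> l"
  show le: "?l \<le> m" by (rule Least_le) simp
  have "ceil_mult \<alpha> m \<le> ceil_mult \<alpha> ?l" by (rule LeastI[of _ m]) simp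
  then have "real (ceil_mult \<alpha> m) \<le> real (ceil_mult \<alpha> ?l)" by (simp only: of_nat_le_iff)
  then have "\<alpha> * real m < \<alpha> * real ?l + 1"
    using ceil_mult_bounds(1)[OF assms(1), of m] ceil_mult_bounds(2)[OF assms(1), of ?l] by linarith
  then have "\<alpha> * (real m - real ?l) < 1" by (simp add: right_diff_distrib)
  then have "real m - real ?l < 1 / \<alpha>" using assms(1) by (simp add: pos_less_divide_eq mult.commute)
  then have "real (m - ?l) < real (2 ^ K)" using le assms(2) by (simp add: of_nat_diff)
  then show "m - ?l < 2 ^ K" by (simp only: of_nat_less_iff)
qed

section \<open>Extraction\<close>

theorem theorem30:
  fixes U :: "bool list \<Rightarrow> bool list option" and k :: nat and \<alpha> \<beta> :: real
  assumes "optimal_machine U"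
    and "k \<ge> 1"
    and "0 < \<alpha>" and "\<alpha> < 1" and "0 < \<beta>" and "\<beta> < 1"
    and "computable_real \<alpha>" and "computable_real \<beta>"
    and "\<beta> = real k * \<alpha> / (1 + (real k - 1) * \<alpha>)"
  shows "\<exists>(\<Gamma> :: nat \<Rightarrow> bool list \<Rightarrow> bool list option) (d :: nat).
    (\<forall>i\<in>{1..k}. partial_computable (\<Gamma> i)) \<and>
    (\<forall>i\<in>{1..k}. \<forall>n x y. int (length x) = \<lfloor>(\<beta> / \<alpha>) * real n\<rfloor> \<and> \<Gamma> i x = Some y
        \<longrightarrow> length y = n) \<and>
    (\<forall>n x. int (length x) = \<lfloor>(\<beta> / \<alpha>) * real n\<rfloor> \<and>
        ereal_of_enat (complexity U x) \<ge> ereal (\<alpha> * real (length x) + real d)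
        \<longrightarrow> (\<exists>i\<in>{1..k}. \<exists>y. \<Gamma> i x = Some y \<and>
              ereal_of_enat (complexity U y) \<ge> ereal (\<beta> * real n - real d)))"
proof -

  \<comment> \<open>Simple values and rounds for each input length\<close>
  obtain rU where rU: "\<And>x y. U x = Some y \<longleftrightarrow> evals rU [str_code x] (str_code y)"
    using assms(1) unfolding optimal_machine_def partial_computable_def by blast
  obtain T where T: "step_function rU 1 T" using ex_step_function by blast
  define A where "A = ceil_mult \<alpha>"
  define L where "L = out_length \<alpha> k"
  \<comment> \<open>String number \<open>v\<close> of length \<open>L m\<close> is known at time
    \<open>t\<close> to be simple. \<open>T\<close> returns the successor of its code, so no 1 is
    subtracted.\<close>
  define hit where "hit m t v \<longleftrightarrow> (\<exists>p<2 ^ A m - 1. T t [p] = v + 2 ^ L m)" for m t v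
  define ev where "ev m i = event (2 ^ m) (2 ^ L m) (hit m) i" for m i
  obtain K where K: "1 / \<alpha> \<le> 2 ^ K"
    using real_arch_pow[of 2 "1 / \<alpha>"] by (auto dest: less_imp_le)

  \<comment> \<open>Computability of the rounds\<close>
  have rec_A: "recursive n (\<lambda>xs. A (f xs))" if "recursive n f" for n f
    using recursive_unary[OF recursive_nat_ceiling_mult[OF assms(7,3,4)] that]
    by (simp add: A_def ceil_mult_def)
  have rec_L: "recursive n (\<lambda>xs. L (f xs))" if "recursive n f" for n f
    unfolding L_def out_length_def A_def[symmetric] by (intro rec_intros rec_A that)
  have "recursive 2 (\<lambda>ys. T (arg 0 ys) [arg 1 ys])"
    using step_functionD(1)[OF T]
    by (subst recursive_cong[of 2 _ "\<lambda>ys. T (arg 0 ys) (tl ys)"]) (auto simp: length_Suc_conv numeral_2_eq_2)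
  note rec_T = recursive_binary[of "\<lambda>t p. T t [p]", OF this]
  have dec_hit: "decidable 3 (\<lambda>xs. hit (arg 0 xs) (arg 1 xs) (arg 2 xs))"
    unfolding hit_def by (intro rec_intros rec_A rec_L rec_T)
  have "decidable 2 (\<lambda>xs. ev (arg 0 xs) i (arg 1 xs))" for i
    unfolding ev_def by (intro decidable_event dec_hit rec_intros rec_L)
  note dec_ev = decidable_binary[of "\<lambda>m. ev m i" for i, OF this]
  have rec_rank: "recursive n (\<lambda>xs. rank (ev (f xs) i) (g xs))" if "recursive n f" "recursive n g" for n f g i
  proof -
    have "recursive 2 (\<lambda>xs. rank (ev (arg 0 xs) i) (arg 1 xs))"
      unfolding rank_def by (intro rec_intros dec_ev)
    from recursive_binary[of "\<lambda>m. rank (ev m i)", OF this that] show ?thesis .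
  qed

  \<comment> \<open>The extraction functions\<close>
  define P\<Gamma> where "P\<Gamma> i z c \<longleftrightarrow>
      ev (code_length c) (i - 1) z \<and> z mod 2 ^ code_length c = Suc c - 2 ^ code_length c" for i z c
  \<comment> \<open>Events are numbered from 0 and \<open>\<Gamma>\<close> from 1, hence
    \<open>i - 1\<close>. The rank modulo the number of outputs selects the string received in this
    round.\<close>
  define h\<Gamma> where "h\<Gamma> i z c = rank (ev (code_length c) (i - 1)) z mod 2 ^ L (code_length c)
      + 2 ^ L (code_length c) - 1" for i z c
  \<comment> \<open>\<open>\<Gamma> i x\<close> waits until \<open>x\<close> enters its round and is
    undefined if that never happens.\<close>
  define \<Gamma> where "\<Gamma> i x = (if \<exists>z. P\<Gamma> i z (str_code x)
      then Some (inv str_code (h\<Gamma> i (LEAST z. P\<Gamma> i z (str_code x)) (str_code x))) else None)" for i x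
  have \<Gamma>_computable: "partial_computable (\<Gamma> i)" for i
    unfolding \<Gamma>_def
  proof (rule partial_computable_search)
    show "decidable 2 (\<lambda>xs. P\<Gamma> i (arg 0 xs) (arg 1 xs))"
      unfolding P\<Gamma>_def by (intro rec_intros dec_ev)
    show "recursive 2 (\<lambda>xs. h\<Gamma> i (arg 0 xs) (arg 1 xs))"
      unfolding h\<Gamma>_def by (intro rec_intros rec_rank rec_L)
  qed
  have \<Gamma>_length: "length y = L (length x)" if "\<Gamma> i x = Some y" for i x y
    using that by (auto simp: \<Gamma>_def h\<Gamma>_def length_inv_str_code[unfolded One_nat_def] split: if_splits)

  define index where "index x = Suc (str_code x) - 2 ^ length x" for x
  have index_less: "index x < 2 ^ length x" for x
    using str_code_bounds[of x] by (simp add: index_def)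
  have \<Gamma>_eq: "\<Gamma> (Suc i) x = Some (inv str_code (rank (ev (length x) i) z mod 2 ^ L (length x) + 2 ^ L (length x) - 1))"
    if z: "ev (length x) i z" "z mod 2 ^ length x = index x" for i x z
  proof -
    have P: "P\<Gamma> (Suc i) z (str_code x)" using z by (simp add: P\<Gamma>_def index_def)
    have "w = z" if "P\<Gamma> (Suc i) w (str_code x)" for w
      using that z event_unique by (simp add: P\<Gamma>_def index_def ev_def) metis
    then have "(LEAST z. P\<Gamma> (Suc i) z (str_code x)) = z"
      using P by (metis LeastI)
    then show ?thesis using P by (auto simp: \<Gamma>_def h\<Gamma>_def)
  qed
  \<comment> \<open>A short program for the value is eventually seen to halt; then the value is hit
    and \<open>x\<close> enters the next round.\<close>
  have advance: "\<exists>w. ev (length x) (Suc i) w \<and> w mod 2 ^ length x = index x"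
    if z: "ev (length x) i z" "z mod 2 ^ length x = index x"
      and y: "\<Gamma> (Suc i) x = Some y" "complexity U y < enat (A (length x))" for i x y z
  proof -
    let ?v = "rank (ev (length x) i) z mod 2 ^ L (length x)"
    obtain p where p: "U p = Some y" "length p < A (length x)" using complexity_lessD[OF y(2)] by blast
    have "Suc (str_code y) = ?v + 2 ^ L (length x)"
      using y(1) \<Gamma>_eq[OF z] by auto
    moreover obtain t where "T t [str_code p] = Suc (str_code y)"
      using step_functionD(2)[OF T, of "[str_code p]" "str_code y"] p(1) rU by auto
    moreover have "str_code p < 2 ^ A (length x) - 1"
    proof -
      have "(2::nat) ^ Suc (length p) \<le> 2 ^ A (length x)" using p(2) by (intro power_increasing) auto
      then show ?thesis using str_code_bounds(2)[of p] by linarith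
    qed
    ultimately have "hit (length x) t ?v" unfolding hit_def by auto
    moreover have "hit (length x) t' v" if t: "t \<le> t'" and v: "hit (length x) t v" for t t' v
    proof -
      obtain p where p: "p < 2 ^ A (length x) - 1" "T t [p] = v + 2 ^ L (length x)"
        using v by (auto simp: hit_def)
      then have "T t [p] = Suc (v + 2 ^ L (length x) - 1)" by simp
      from step_functionD(4)[OF T _ this t] p(1) show ?thesis
        unfolding hit_def by (intro exI[of _ p]) simp
    qed
    ultimately show ?thesis
      using ex_event_Suc[of "2 ^ length x" "2 ^ L (length x)" "hit (length x)" i z t] z
      by (simp only: ev_def) simp
  qed

  \<comment> \<open>A machine for the strings that leave the last round\<close>
  txt \<open>A description of \<open>x\<close> has length \<open>A m + e\<close>, which yields \<open>A m\<close>; its \<open>K\<close> low bits give the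
    distance from \<open>m\<close> to the least \<open>l\<close> with \<open>A l = A m\<close>, the others the rank of \<open>x\<close> in the last round.\<close>
  define e where "e = k + 1 + K"
  define size where "size c = code_length c - e" for c
  define payload where "payload c = Suc c - 2 ^ code_length c" for c
  define len where "len c = (LEAST l. size c \<le> A l) + payload c mod 2 ^ K" for c
  \<comment> \<open>The last function serves round \<open>k - 1\<close>, so entering round
    \<open>k\<close> means that every value of \<open>x\<close> was simple.\<close>
  define PV where "PV z c \<longleftrightarrow> ev (len c) k z \<and> rank (ev (len c) k) z = payload c div 2 ^ K" for z c
  define hV where "hV z c = z mod 2 ^ len c + 2 ^ len c - 1" for z c :: nat
  define V where "V x = (if \<exists>z. PV z (str_code x)
      then Some (inv str_code (hV (LEAST z. PV z (str_code x)) (str_code x))) else None)" for x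
  have ex_A: "\<exists>l. s \<le> A l" for s
  proof -
    obtain l :: nat where "real s < real l * \<alpha>" using reals_Archimedean3[OF assms(3)] by blast
    then have "real s \<le> real (A l)"
      using ceil_mult_bounds(1)[OF assms(3), of l] by (simp add: A_def mult.commute)
    then show ?thesis by auto
  qed
  have rec_len: "recursive n (\<lambda>xs. len (f xs))" if "recursive n f" for n f
  proof -
    have "recursive 1 (\<lambda>xs. len (arg 0 xs))"
      unfolding len_def size_def payload_def by (intro rec_intros rec_A ex_A)
    from recursive_unary[of len, OF this that] show ?thesis .
  qed
  have V_computable: "partial_computable V"
    unfolding V_def
  proof (rule partial_computable_search)
    show "decidable 2 (\<lambda>xs. PV (arg 0 xs) (arg 1 xs))"
      unfolding PV_def payload_def by (intro rec_intros dec_ev rec_rank rec_len)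
    show "recursive 2 (\<lambda>xs. hV (arg 0 xs) (arg 1 xs))"
      unfolding hV_def by (intro rec_intros rec_len)
  qed
  have described: "complexity V x \<le> enat (A (length x) + e)"
    if z: "ev (length x) k z" "z mod 2 ^ length x = index x" for x z
  proof -
    let ?m = "length x"
    define s a l where "s = A ?m" and "a = ?m - (LEAST l. s \<le> A l)" and "l = s + e"
    define v where "v = rank (ev ?m k) z * 2 ^ K + a"
    have a: "a < 2 ^ K" "(LEAST l. s \<le> A l) + a = ?m"
      using least_preimage_close[OF assms(3) K, of ?m] by (simp_all add: a_def s_def A_def)
    have "card {v. v < 2 ^ L ?m \<and> (\<exists>t. hit ?m t v)} \<le> 2 ^ s"
      unfolding hit_def s_def by (rule card_hits_le[OF T])
    from card_event_le[OF this, of "L ?m - s" ?m k k]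
    have "card {z. ev ?m k z} \<le> 2 ^ (s + k) + k * 2 ^ s"
      using out_length_bounds[OF assms(3,4,2), of ?m] by (simp add: ev_def A_def L_def s_def)
    \<comment> \<open>\<open>k \<le> 2 ^ k\<close> merges both terms into
      \<open>2 ^ (s + k + 1)\<close>; this is the summand \<open>k + 1\<close> in
      \<open>e\<close>.\<close>
    also have "\<dots> \<le> 2 ^ (s + k) + 2 ^ k * 2 ^ s"
      by (intro add_left_mono mult_right_mono) (auto intro: less_imp_le)
    also have "\<dots> = 2 ^ (s + k + 1)" by (simp add: power_add)
    finally have card: "card {z. ev ?m k z} \<le> 2 ^ (s + k + 1)" .
    have "rank (ev ?m k) z < card {z. ev ?m k z}"
      using z(1) by (intro rank_less_card) (simp_all add: ev_def finite_events)
    then have "rank (ev ?m k) z + 1 \<le> 2 ^ (s + k + 1)" using card by simp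
    then have "(rank (ev ?m k) z + 1) * 2 ^ K \<le> 2 ^ (s + k + 1) * 2 ^ K" by (rule mult_le_mono1)
    also have "\<dots> = 2 ^ l" by (simp add: l_def e_def power_add)
    finally have v: "v < 2 ^ l" using a(1) by (simp add: v_def)
    define w where "w = inv str_code (v + 2 ^ l - 1)"
    have w: "length w = l" "Suc (str_code w) = v + 2 ^ l"
      using length_inv_str_code[OF v] by (simp_all add: w_def)
    have "payload (str_code w) = v" "size (str_code w) = s"
      using w by (simp_all add: payload_def size_def l_def)
    then have len: "len (str_code w) = ?m" and div: "payload (str_code w) div 2 ^ K = rank (ev ?m k) z"
      using a by (simp_all add: len_def v_def)
    have P: "PV z (str_code w)" using z(1) by (simp add: PV_def len div)
    have "u = z" if "PV u (str_code w)" for u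
      using that z(1) by (auto simp: PV_def len div intro: rank_inj)
    then have least: "(LEAST z. PV z (str_code w)) = z" using P by (metis LeastI)
    have "hV z (str_code w) = str_code x"
      using z(2) str_code_bounds(1)[of x] by (simp add: hV_def len index_def)
    then have "V w = Some x" using P by (auto simp: V_def least)
    from complexity_le[of V, OF this] show ?thesis by (simp add: w l_def s_def)
  qed
  obtain cV where cV: "\<And>s. complexity U s \<le> complexity V s + enat cV"
    using assms(1) V_computable unfolding optimal_machine_def by blast
  \<comment> \<open>\<open>d\<close> absorbs the overhead \<open>e\<close> of the description, the
    cost \<open>cV\<close> of passing from \<open>V\<close> to \<open>U\<close>, and the rounding
    errors, each at most 1, in \<open>A\<close> and between \<open>\<beta> * n\<close> and
    \<open>\<alpha> * m\<close>.\<close>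
  define d where "d = e + cV + 2"

  \<comment> \<open>Some value of a complex string is complex\<close>
  have good: "\<exists>i\<in>{1..k}. \<exists>y. \<Gamma> i x = Some y \<and> ereal_of_enat (complexity U y) \<ge> ereal (\<beta> * real n - real d)"
    if m: "int (length x) = \<lfloor>(\<beta> / \<alpha>) * real n\<rfloor>"
      and x: "ereal_of_enat (complexity U x) \<ge> ereal (\<alpha> * real (length x) + real d)" for n x
  proof (rule ccontr)
    assume neg: "\<not> ?thesis"
    \<comment> \<open>If the conclusion fails, every defined value is simple, because
      \<open>\<beta> * n - d\<close> is at most \<open>A (length x)\<close>.\<close>
    have simple: "complexity U y < enat (A (length x))" if "i \<in> {1..k}" "\<Gamma> i x = Some y" for i y
    proof -
      have "\<not> ereal_of_enat (complexity U y) \<ge> ereal (\<beta> * real n - real d)" using neg that by blast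
      then obtain q where q: "complexity U y = enat q" "real q < \<beta> * real n - real d"
        by (cases "complexity U y") auto
      moreover have "\<beta> * real n - real d \<le> real (A (length x))"
        using length_eq_out_length(2)[OF assms(3,4,2,9) m] ceil_mult_bounds(1)[OF assms(3), of "length x"]
        by (simp add: A_def d_def)
      ultimately have "real q < real (A (length x))" by linarith
      then show ?thesis by (simp add: q(1))
    qed
    \<comment> \<open>\<open>x\<close> enters round 0 at time \<open>index x\<close> and by
      \<open>advance\<close> passes through all rounds; the machine \<open>V\<close> then describes
      it too briefly.\<close>
    have "\<exists>z. ev (length x) i z \<and> z mod 2 ^ length x = index x" if "i \<le> k" for i
      using that
    proof (induction i)
      case 0
      show ?case using index_less[of x] by (intro exI[of _ "index x"]) (simp add: ev_def)
    next
      case (Suc i)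
      then obtain z where z: "ev (length x) i z" "z mod 2 ^ length x = index x" by auto
      show ?case by (rule advance[OF z \<Gamma>_eq[OF z] simple[OF _ \<Gamma>_eq[OF z]]]) (use Suc.prems in auto)
    qed
    then obtain z where z: "ev (length x) k z" "z mod 2 ^ length x = index x" by blast
    have "complexity U x \<le> enat (A (length x) + e) + enat cV"
      using cV[of x] described[OF z] by (meson add_right_mono order_trans)
    then obtain q where q: "complexity U x = enat q" "q \<le> A (length x) + e + cV"
      by (cases "complexity U x") auto
    then have "real q \<le> real (A (length x)) + real e + real cV"
      by (metis of_nat_add of_nat_le_iff)
    moreover have "\<alpha> * real (length x) + real d \<le> real q" using x q(1) by simp
    ultimately show False
      using ceil_mult_bounds(2)[OF assms(3), of "length x"] by (simp add: A_def d_def)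
  qed
  show ?thesis
  proof (rule exI[of _ \<Gamma>], rule exI[of _ d], intro conjI ballI allI impI)
    fix i n x y assume "int (length x) = \<lfloor>(\<beta> / \<alpha>) * real n\<rfloor> \<and> \<Gamma> i x = Some y"
    then show "length y = n"
      using \<Gamma>_length length_eq_out_length(1)[OF assms(3,4,2,9)] by (metis L_def)
  qed (use \<Gamma>_computable good in blast)+
qed

end
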